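(* Let $d,N\ge 1$ be integers, let $0\le \mu<L<\infty$, and let $\gamma\in(0,2/L)$. Let $f:\mathbb{R}^d\to\mathbb{R}$ be a differentiable function that is $\mu$-strongly convex and $L$-smooth and that has a minimizer. Let $x_*$ be any minimizer of $f$ and put $f_*=f(x_* )$. Let $x_0\in\mathbb{R}^d$ and let $x_{k+1}=x_k-\gamma\nabla f(x_k)$ for $k=0,1,\ldots,N-1$. Then $$f(x_N)-f_*\le \max\left\{\frac{1}{1+\gamma L\sum_{j=1}^{2N}(1-\gamma\mu)^{-j}},\ (1-\gamma L)^{2N}\right\}\frac{L\|x_0-x_*\|^2}{2}.$$
   Context: $\|\cdot\|$ and $\langle\cdot,\cdot\rangle$ are the Euclidean norm and inner product on $\mathbb{R}^d$. A differentiable function $f$ on $\mathbb{R}^d$ is called $\mu$-strongly convex if $0\ge f(p)-f(q)+\langle\nabla f(p),q-p\rangle+\frac{\mu}{2}\|p-q\|^2$ for all $p,q\in\mathbb{R}^d$, and $L$-smooth if $0\le f(p)-f(q)+\langle\nabla f(p),q-p\rangle+\frac{L}{2}\|p-q\|^2$ for all $p,q\in\mathbb{R}^d$. Convention: if $1-\gamma\mu=0$, the sum $\sum_{j=1}^{2N}(1-\gamma\mu)^{-j}$ is interpreted as $+\infty$, so that the first argument of the maximum equals $0$. *)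

theory Defs
  imports "HOL-Analysis.Analysis"
begin

text \<open>The gradient, i.e. the Riesz representative of the Frechet derivative. It is meaningful
  only where \<^term>\<open>f\<close> is differentiable; see \<open>GDERIV_grad\<close> and \<open>grad_eq\<close>.\<close>

definition grad :: "('a::euclidean_space \<Rightarrow> real) \<Rightarrow> 'a \<Rightarrow> 'a" where
  "grad f x = (THE D. GDERIV f x :> D)"

lemma grad_eq:
  fixes f :: "'a::euclidean_space \<Rightarrow> real"
  assumes "GDERIV f x :> D"
  shows "grad f x = D"
  unfolding grad_def
proof (rule the_equality)
  fix E assume "GDERIV f x :> E"
  then have "(\<lambda>h. inner h E) = (\<lambda>h. inner h D)"
    using assms unfolding gderiv_def by (rule has_derivative_unique)
  then show "E = D"
    by (simp add: fun_eq_iff vector_eq_ldot)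
qed (rule assms)

lemma GDERIV_grad:
  fixes f :: "'a::euclidean_space \<Rightarrow> real"
  assumes "f differentiable (at x)"
  shows "GDERIV f x :> grad f x"
proof -
  obtain F where F: "(f has_derivative F) (at x)"
    using assms by (auto simp: differentiable_def)
  then have lin: "linear F"
    by (rule has_derivative_linear)
  have "F h = inner h (\<Sum>b\<in>Basis. F b *\<^sub>R b)" for h
  proof -
    have "F h = F (\<Sum>b\<in>Basis. inner h b *\<^sub>R b)"
      by (simp add: euclidean_representation)
    also have "\<dots> = (\<Sum>b\<in>Basis. inner h b * F b)"
      by (simp add: linear_sum[OF lin] linear_cmul[OF lin])
    finally show ?thesis
      by (simp add: inner_sum_right mult.commute)
  qed
  then have "F = (\<lambda>h. inner h (\<Sum>b\<in>Basis. F b *\<^sub>R b))"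
    by blast
  with F have "GDERIV f x :> (\<Sum>b\<in>Basis. F b *\<^sub>R b)"
    unfolding gderiv_def by simp
  then show ?thesis
    by (simp add: grad_eq)
qed

text \<open>Both notions below are meant for differentiable \<^term>\<open>f\<close>; differentiability is not
  part of the definitions.\<close>

definition strongly_convex :: "real \<Rightarrow> ('a::euclidean_space \<Rightarrow> real) \<Rightarrow> bool" where
  "strongly_convex \<mu> f \<longleftrightarrow>
     (\<forall>p q. 0 \<ge> f p - f q + inner (grad f p) (q - p) + \<mu> / 2 * (norm (p - q))\<^sup>2)"

definition smooth :: "real \<Rightarrow> ('a::euclidean_space \<Rightarrow> real) \<Rightarrow> bool" where
  "smooth L f \<longleftrightarrow>
     (\<forall>p q. 0 \<le> f p - f q + inner (grad f p) (q - p) + L / 2 * (norm (p - q))\<^sup>2)"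

text \<open>The reciprocal of \<open>1 + \<gamma> L \<Sum>\<^sub>j (1 - \<gamma> \<mu>)\<^sup>-\<^sup>j\<close>, for \<open>j\<close> from \<open>1\<close> to \<open>2 N\<close>. If
  \<open>1 - \<gamma> \<mu> = 0\<close>, the sum is read as \<open>+\<infinity>\<close> and the reciprocal as \<open>0\<close>; this needs a separate
  case because \<open>1 / 0 = 0\<close> in HOL would make the reciprocal \<open>1\<close>.\<close>

definition sum_rate :: "real \<Rightarrow> real \<Rightarrow> real \<Rightarrow> nat \<Rightarrow> real" where
  "sum_rate \<mu> L \<gamma> N =
     (if 1 - \<gamma> * \<mu> = 0 then 0
      else 1 / (1 + \<gamma> * L * (\<Sum>j = 1..2 * N. (1 - \<gamma> * \<mu>) powi (- int j))))"

end

theory Submission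
  imports Defs
begin

text \<open>Rescale to \<open>\<gamma> = 1\<close>, put \<open>r = 1 - \<mu>\<close> and split off the quadratic part of \<open>f\<close>, so that the
  iteration becomes \<open>a\<^sub>k\<^sub>+\<^sub>1 = r a\<^sub>k - y\<^sub>k\<close> with \<open>y\<^sub>k\<close> the gradient at \<open>a\<^sub>k\<close> of a convex function \<open>h\<close>.
  Call \<open>x\<close> the threshold of \<open>r\<close> if the two rates in the maximum agree when \<open>1 - L = - x\<close>. At the threshold
  both a Huber-type function and a pure quadratic are extremal, and the certificate uses only the
  cocoercivity inequalities between \<open>i < j\<close>, with weights of the product form \<open>u\<^sub>i v\<^sub>j\<close>, and those
  between the minimizer and \<open>j\<close>. Because of the product form these can be summed backwards:
  only two combinations of \<open>y\<^sub>j, \<dots>, y\<^sub>N\<close> have to be carried along (\<open>avg\<close>, with weights proportional to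
  the \<open>v\<^sub>i\<close>, and \<open>bal\<close>, whose weights balance the function values), and in each step the slack is a single square.

  The same weights work below the threshold, that is for \<open>1 - L \<ge> - x\<close>: the surplus cocoercivity is used
  up by Jensen's inequality. Above it one lowers \<open>\<mu>\<close>, possibly to a negative value, until
  \<open>L - 1\<close> is the threshold; this does not change \<open>(1 - L)\<^sup>2\<^sup>N\<close>.\<close>

section \<open>Geometric sums\<close>

definition geo :: "real \<Rightarrow> nat \<Rightarrow> real" where
  "geo r k = (\<Sum>i<k. r ^ i)"

lemma geo_0 [simp]: "geo r 0 = 0" and geo_1 [simp]: "geo r (Suc 0) = 1"
  by (simp_all add: geo_def)

lemma geo_add: "geo r (m + n) = geo r m + r ^ m * geo r n"
  by (induction n) (simp_all add: geo_def power_add algebra_simps)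

lemma geo_Suc: "geo r (Suc k) = 1 + r * geo r k"
  using geo_add[of r 1 k] by simp

lemma geo_mult: "(1 - r) * geo r k = 1 - r ^ k"
  by (simp add: geo_def one_diff_power_eq)

lemma geo_nonneg: "r \<ge> 0 \<Longrightarrow> geo r k \<ge> 0"
  by (simp add: geo_def sum_nonneg)

lemma geo_pos: "r > 0 \<Longrightarrow> k > 0 \<Longrightarrow> geo r k > 0"
  by (cases k) (auto simp: geo_Suc intro!: add_pos_nonneg mult_nonneg_nonneg geo_nonneg)

lemma geo_inverse: "r \<noteq> 0 \<Longrightarrow> r ^ k * geo (1 / r) k = r * geo r k"
proof (induction k)
  case (Suc k)
  then show ?case
    by (simp add: geo_Suc[of r]) (simp add: geo_def field_simps)
qed simp

lemma geo_even: "geo r (2 * k) = (1 + r) * geo (r\<^sup>2) k"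
  by (induction k) (simp_all add: geo_def power_mult algebra_simps power2_eq_square)

lemma geo_even_mult: "geo r (2 * k) = geo r k * (1 + r ^ k)"
  using geo_add[of r k k] by (simp add: mult_2[symmetric] algebra_simps)

text \<open>For positive \<open>g\<close>, \<open>fg\<close> says that \<open>f / g\<close>
  increases. The product of the two sums over \<open>i < m\<close> is common to both sides; what
  remains compares this head with the block from \<open>m\<close> to \<open>n\<close>, where every
  pair has \<open>i < j\<close>.\<close>

lemma sum_quotient_less:
  fixes f g :: "nat \<Rightarrow> real"
  assumes mn: "0 < m" "m < n" and fg: "\<And>i j. i < j \<Longrightarrow> f i * g j < f j * g i"
  shows "(\<Sum>i<m. f i) * (\<Sum>i<n. g i) < (\<Sum>i<n. f i) * (\<Sum>i<m. g i)"
proof -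
  have split: "(\<Sum>i<n. h i) = (\<Sum>i<m. h i) + (\<Sum>i=m..<n. h i)" for h :: "nat \<Rightarrow> real"
    using mn by (metis atLeast0LessThan le0 less_imp_le sum.atLeastLessThan_concat)
  have "(\<Sum>i<m. f i) * (\<Sum>i=m..<n. g i) = (\<Sum>(i, j)\<in>{..<m} \<times> {m..<n}. f i * g j)"
    by (simp add: sum_product sum.cartesian_product)
  also have "\<dots> < (\<Sum>(i, j)\<in>{..<m} \<times> {m..<n}. f j * g i)"
    using mn by (intro sum_strict_mono) (auto intro: fg)
  also have "\<dots> = (\<Sum>i=m..<n. f i) * (\<Sum>i<m. g i)"
    by (simp add: sum_product sum.cartesian_product[symmetric] sum.swap[of _ "{..<m}"])
  finally show ?thesis
    by (simp add: split algebra_simps)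
qed

lemma geo_quotient_less:
  assumes "0 < a" "a < b" "0 < m" "m < n"
  shows "geo a n * geo b m < geo a m * geo b n"
proof -
  have "b ^ i * a ^ j < b ^ j * a ^ i" if "i < j" for i j
  proof -
    from that obtain k where k: "j = i + k" "0 < k"
      using less_imp_add_positive by blast
    show ?thesis
      using assms power_strict_mono[of a b k] k by (simp add: power_add)
  qed
  from sum_quotient_less[where f = "\<lambda>i. b ^ i" and g = "\<lambda>i. a ^ i", OF assms(3,4) this]
  show ?thesis by (simp add: geo_def mult.commute)
qed

text \<open>In the variables \<open>q = exp (2 \<sigma>)\<close>, \<open>h = exp (- 2 \<tau>)\<close> this says that
  \<open>sinh (k \<tau>) / sinh (k \<sigma>)\<close> increases with \<open>k\<close> when \<open>\<bar>\<sigma>\<bar> \<le> \<tau>\<close>.\<close>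

lemma geo_shift2_le:
  assumes q: "0 < q" and h: "0 < h" "h \<le> q" "h * q \<le> 1"
  shows "h * geo q (k + 2) * geo h k \<le> q * geo q k * geo h (k + 2)"
proof -
  let ?f = "\<lambda>i. q ^ Suc i * (1 + h ^ Suc k) - h ^ Suc i * (1 + q ^ Suc k)"
  \<comment> \<open>A single \<open>?f i\<close> can be negative. Together with its mirror image it
    becomes a sum of two products of nonnegative factors.\<close>
  have "0 \<le> ?f i + ?f (k - Suc i)" if "i < k" for i
  proof -
    define l where "l = Suc (k - Suc i)"
    have k: "Suc k = Suc i + l" using that by (simp add: l_def)
    have pw: "(h * q) ^ m \<le> 1" "h ^ m \<le> q ^ m" for m
      using q h by (auto intro: power_le_one power_mono)
    have "?f i + ?f (k - Suc i) = (q ^ Suc i - h ^ Suc i) * (1 - (h * q) ^ l) + (q ^ l - h ^ l) * (1 - (h * q) ^ Suc i)"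
      unfolding l_def[symmetric] k by (simp only: power_add power_mult_distrib) (simp add: algebra_simps)
    then show ?thesis using pw[of l] pw[of "Suc i"] by simp
  qed
  then have "0 \<le> (\<Sum>i<k. ?f i + ?f (k - Suc i))" by (intro sum_nonneg) auto
  also have "\<dots> = 2 * (\<Sum>i<k. ?f i)"
    using sum.nat_diff_reindex[of ?f k] by (simp only: sum.distrib mult_2)
  also have "(\<Sum>i<k. ?f i) = q * geo q k * (1 + h ^ Suc k) - h * geo h k * (1 + q ^ Suc k)"
    by (simp only: sum_subtractf sum_distrib_right[symmetric] power_Suc sum_distrib_left[symmetric] geo_def)
  finally have *: "h * geo h k * (1 + q ^ Suc k) \<le> q * geo q k * (1 + h ^ Suc k)" by simp
  have two: "geo p (k + 2) = 1 + p ^ Suc k + p * geo p k" for p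
    using geo_Suc[of p "Suc k"] by (simp add: geo_def algebra_simps)
  show ?thesis unfolding two using * by (simp add: algebra_simps)
qed

text \<open>Iterates \<open>geo_shift2_le\<close> along \<open>k, k + 2, ...\<close>; the
  intermediate sums \<open>geo q ?m\<close> and \<open>geo h ?m\<close> cancel.\<close>

lemma geo_shift_le:
  assumes q: "0 < q" and h: "0 < h" "h \<le> q" "h * q \<le> 1"
  shows "h ^ n * geo q (k + 2 * n) * geo h k \<le> q ^ n * geo q k * geo h (k + 2 * n)"
proof (cases "k = 0")
  case False
  show ?thesis
  proof (induction n)
    case (Suc n)
    let ?m = "k + 2 * n"
    have pos: "geo q ?m > 0" "geo h ?m > 0" "geo q k > 0" "geo h k > 0"
      using q h False by (simp_all add: geo_pos)
    have nn: "geo q (?m + 2) \<ge> 0" "geo h (?m + 2) \<ge> 0"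
      using q h by (simp_all add: geo_nonneg)
    have "(h ^ n * geo q ?m * geo h k) * (h * geo q (?m + 2) * geo h ?m)
        \<le> (q ^ n * geo q k * geo h ?m) * (q * geo q ?m * geo h (?m + 2))"
      by (rule mult_mono[OF Suc geo_shift2_le[OF q h]]) (use q h pos nn in simp_all)
    then have "(h ^ Suc n * geo q (?m + 2) * geo h k) * (geo q ?m * geo h ?m)
        \<le> (q ^ Suc n * geo q k * geo h (?m + 2)) * (geo q ?m * geo h ?m)"
      by (simp add: mult_ac)
    then have "h ^ Suc n * geo q (?m + 2) * geo h k \<le> q ^ Suc n * geo q k * geo h (?m + 2)"
      using pos by (simp add: mult_le_cancel_right)
    then show ?case by simp
  qed simp
qed simp

text \<open>This is \<open>geo_shift_le\<close> for \<open>1 / r\<close> and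
  \<open>x\<^sup>2 / r\<close>, whose two conditions become \<open>x\<^sup>2 \<le> 1\<close> and
  \<open>x\<^sup>2 \<le> r\<^sup>2\<close>. It is made for \<open>gap_xpow_le\<close>.\<close>

lemma geo_shift_scaled:
  assumes r: "r > 0" and x: "x > 0" "x < r" "x < 1"
  shows "x ^ (2 * n) * geo r (k + 2 * n) * (r ^ k - x ^ (2 * k)) \<le> geo r k * (r ^ (k + 2 * n) - x ^ (2 * (k + 2 * n)))"
proof -
  define h where "h = x\<^sup>2 / r"
  have "x * x < x * 1" "x * x \<le> r * r"
    using x by (auto intro: mult_strict_left_mono mult_mono)
  then have sq: "x * x < r" "x * x \<le> 1" "x * x \<le> r * r"
    using x by linarith+
  have h: "0 < h" "h \<le> 1 / r" "h * (1 / r) \<le> 1" "h < 1"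
    using r x sq by (simp_all add: h_def power2_eq_square divide_right_mono)
  have rh: "r ^ m * h ^ m = x ^ (2 * m)" for m
    using r by (simp add: h_def power_divide power_mult)
  have "(1 - h) * (h ^ n * geo (1 / r) (k + 2 * n) * geo h k) \<le> (1 - h) * ((1 / r) ^ n * geo (1 / r) k * geo h (k + 2 * n))"
    using geo_shift_le[of "1 / r" h n k] r h by (intro mult_left_mono) auto
  then have "h ^ n * geo (1 / r) (k + 2 * n) * (1 - h ^ k) \<le> (1 / r) ^ n * geo (1 / r) k * (1 - h ^ (k + 2 * n))"
    unfolding geo_mult[symmetric] by (simp only: mult_ac)
  then have "r ^ n * r ^ k * r ^ (k + 2 * n) * (h ^ n * geo (1 / r) (k + 2 * n) * (1 - h ^ k))
     \<le> r ^ n * r ^ k * r ^ (k + 2 * n) * ((1 / r) ^ n * geo (1 / r) k * (1 - h ^ (k + 2 * n)))"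
    using r by (intro mult_left_mono) auto
  also have "r ^ n * r ^ k * r ^ (k + 2 * n) * (h ^ n * geo (1 / r) (k + 2 * n) * (1 - h ^ k)) =
     (r ^ n * h ^ n) * (r ^ (k + 2 * n) * geo (1 / r) (k + 2 * n)) * (r ^ k - r ^ k * h ^ k)"
    by (simp add: algebra_simps)
  also have "r ^ n * r ^ k * r ^ (k + 2 * n) * ((1 / r) ^ n * geo (1 / r) k * (1 - h ^ (k + 2 * n))) =
     (r ^ n * (1 / r) ^ n) * (r ^ k * geo (1 / r) k) * (r ^ (k + 2 * n) - r ^ (k + 2 * n) * h ^ (k + 2 * n))"
    by (simp add: algebra_simps)
  also have "r ^ n * (1 / r) ^ n = 1"
    using r by (simp add: power_divide)
  finally have "r * (x ^ (2 * n) * geo r (k + 2 * n) * (r ^ k - x ^ (2 * k)))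
     \<le> r * (geo r k * (r ^ (k + 2 * n) - x ^ (2 * (k + 2 * n))))"
    using r unfolding rh by (simp add: geo_inverse mult_ac)
  then show ?thesis using r by simp
qed

section \<open>One step of the backward summation\<close>

text \<open>The quadratic form on the right of \<open>bound_invariant\<close>. There
  \<open>Z\<close> is \<open>bal y j\<close>, and \<open>W\<close> is
  \<open>avg y j - bal y j\<close>, which vanishes at \<open>j = N\<close>.\<close>

definition bound :: "real \<Rightarrow> real \<Rightarrow> real \<Rightarrow> real \<Rightarrow> real \<Rightarrow> real \<Rightarrow> 'a::real_inner \<Rightarrow> 'a \<Rightarrow> 'a \<Rightarrow> real" where
  "bound r t v P S c a Z W =
     (1 - r) * v * inner a a + 2 * v * (inner a Z + (1 - r) * P * inner a W)
     - (t + S) * inner Z Z + 2 * v * P * inner Z W - c * inner W W"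

text \<open>One step from \<open>j + 1\<close> to \<open>j\<close>, where \<open>\<eta>\<close> is
  the new gradient minus the average of the later ones. Terms in \<open>a\<close> and
  \<open>Z\<close> cancel, those with \<open>inner a \<eta>\<close> and
  \<open>inner Z \<eta>\<close> because of \<open>vS\<close> and the balance equation
  \<open>E\<close>. Only a form in \<open>W\<close> and \<open>\<eta>\<close> survives.\<close>

lemma bound_step:
  fixes a Z W \<eta> :: "'a::real_inner"
  assumes vS: "(1 - r) * S = 1 - v"
    and E: "d * (S + v * (1 + r)) = r * v + r\<^sup>2 * v * P * g"
  shows "bound r t (r\<^sup>2 * v) P (S + v * (1 + r)) c a (Z + d *\<^sub>R \<eta>) (W + g *\<^sub>R \<eta>)
      - bound r t v (1 + r * P) S c' (r *\<^sub>R a - (Z + W + \<eta>)) Z W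
      - 2 * d * inner (a - t *\<^sub>R (Z + W + \<eta>)) \<eta> =
    (c' - c + (1 - r) * v * (1 + 2 * r * P)) * inner W W
     + 2 * (r\<^sup>2 * v * P * d - c * g + d * t + (1 - r) * v * (r * P)) * inner W \<eta>
     + (2 * d * t - (t + S + v * (1 + r)) * d\<^sup>2 + 2 * r\<^sup>2 * v * P * d * g - c * g\<^sup>2 - (1 - r) * v) * inner \<eta> \<eta>"
    (is "?l = ?q")
proof -
  let ?e = "d * (S + v * (1 + r)) - (r * v + r\<^sup>2 * v * P * g)"
  have ZZ: "inner (Z + d *\<^sub>R \<eta>) (Z + d *\<^sub>R \<eta>) = inner Z Z + 2 * d * inner Z \<eta> + d\<^sup>2 * inner \<eta> \<eta>"
    and ZW: "inner (Z + d *\<^sub>R \<eta>) (W + g *\<^sub>R \<eta>) = inner Z W + g * inner Z \<eta> + d * inner W \<eta> + d * g * inner \<eta> \<eta>"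
    and WW: "inner (W + g *\<^sub>R \<eta>) (W + g *\<^sub>R \<eta>) = inner W W + 2 * g * inner W \<eta> + g\<^sup>2 * inner \<eta> \<eta>"
    and aZ: "inner a (Z + d *\<^sub>R \<eta>) = inner a Z + d * inner a \<eta>"
    and aW: "inner a (W + g *\<^sub>R \<eta>) = inner a W + g * inner a \<eta>"
    and bb: "inner (r *\<^sub>R a - (Z + W + \<eta>)) (r *\<^sub>R a - (Z + W + \<eta>)) = r\<^sup>2 * inner a a
      - 2 * r * (inner a Z + inner a W + inner a \<eta>)
      + inner Z Z + inner W W + inner \<eta> \<eta> + 2 * (inner Z W + inner Z \<eta> + inner W \<eta>)"
    and bZ: "inner (r *\<^sub>R a - (Z + W + \<eta>)) Z = r * inner a Z - inner Z Z - inner Z W - inner Z \<eta>"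
    and bW: "inner (r *\<^sub>R a - (Z + W + \<eta>)) W = r * inner a W - inner Z W - inner W W - inner W \<eta>"
    and ae: "inner (a - t *\<^sub>R (Z + W + \<eta>)) \<eta> = inner a \<eta> - t * (inner Z \<eta> + inner W \<eta> + inner \<eta> \<eta>)"
    by (simp_all add: inner_add_left inner_add_right inner_diff_left inner_diff_right algebra_simps
        power2_eq_square inner_commute[of Z a] inner_commute[of W a] inner_commute[of \<eta> a]
        inner_commute[of \<eta> Z] inner_commute[of \<eta> W] inner_commute[of W Z])
  have "?l - ?q = ?e * (- 2 * (1 - r) * inner a \<eta> - 2 * inner Z \<eta>)
      + ((1 - r) * S - (1 - v)) * (2 * d * inner a \<eta>)"
    unfolding bound_def ZZ ZW WW aZ aW bb bZ bW ae
    by algebra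
  then show ?thesis using vS E by simp
qed

text \<open>\<open>R1\<close> and \<open>R0\<close> are \<open>gap_eq\<close> at
  \<open>j + 1\<close> and at \<open>j\<close>; \<open>X\<close>, \<open>D'\<close>,
  \<open>D\<close> stand for \<open>xpow (Suc j)\<close>, \<open>gap (Suc j)\<close>,
  \<open>gap j\<close>. The third relation, divided by \<open>\<theta>\<close>, becomes
  \<open>E\<close> of \<open>bound_step\<close>.\<close>

lemma step_relations:
  fixes r x t v S P X D D' :: real
  assumes pos: "r > 0" "x > 0" "v > 0" and t: "t * (r + x) = 1" and vS: "(1 - r) * S = 1 - v"
    and R1: "X * (v + (1 + x) * S) = v * (1 + (1 + r * P) * (r + x) * D')"
    and R0: "x\<^sup>2 * X * (r\<^sup>2 * v + (1 + x) * (S + v * (1 + r))) = r\<^sup>2 * v * (1 + P * (r + x) * D)"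
  shows "x\<^sup>2 * X * (1 + r) = r - x + r\<^sup>2 * P * D - x\<^sup>2 * (1 + r * P) * D'" (is ?K)
    and "t * (1 + x) * X = v * (X + (1 - r) * (t + (1 + r * P) * D'))" (is ?R2)
    and "x * (1 + x) * X * (S + v * (1 + r)) = r * v * (1 + x * (D' + X)) + r\<^sup>2 * v * P * (D + x * D')" (is ?E)
proof -
  have "v * (r + x) * (x\<^sup>2 * X * (1 + r)) = v * (r + x) * (r - x + r\<^sup>2 * P * D - x\<^sup>2 * (1 + r * P) * D')"
    using R0 R1 by algebra
  then show K: ?K using pos by simp
  have "(r + x) * (t * (1 + x) * X) = (r + x) * (v * (X + (1 - r) * (t + (1 + r * P) * D')))"
    using R1 t vS by algebra
  then show ?R2 using pos by simp
  have "x * (x * (1 + x) * X * (S + v * (1 + r))) = x * (r * v * (1 + x * (D' + X)) + r\<^sup>2 * v * P * (D + x * D'))"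
    using R0 K by algebra
  then show ?E using pos by simp
qed

text \<open>Factors \<open>D\<close> times the coefficient of \<open>2 * inner W \<eta>\<close> in
  \<open>bound_step\<close>. For positive \<open>t\<close> and \<open>d\<close> the sign is that of
  the last factor, which \<open>gap_quotient\<close> controls.\<close>

lemma step_coefficients:
  fixes r x t v S P X D D' \<theta> \<omega> d g c :: real
  assumes t: "t * (r + x) = 1" and pos: "r > 0" "x > 0" "\<theta> \<noteq> 0"
    and K: "x\<^sup>2 * X * (1 + r) = r - x + r\<^sup>2 * P * D - x\<^sup>2 * (1 + r * P) * D'"
    and R2: "t * (1 + x) * X = v * (X + (1 - r) * (t + (1 + r * P) * D'))"
    and th: "\<theta> = 1 + x * (D' + X)"
    and d: "d * \<theta> = x * (1 + x) * X" and g: "g * \<theta> = D + x * D'"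
    and c: "c * D = r\<^sup>2 * v * P * (t * (1 - r) + x\<^sup>2 * X)"
  shows "D * (r\<^sup>2 * v * P * d - c * g + d * t + (1 - r) * v * (r * P)) =
      t * d * ((1 + r * P) * D - x\<^sup>2 * P * D')"
proof -
  have "\<theta> * (D * (r\<^sup>2 * v * P * d - c * g + d * t + (1 - r) * v * (r * P)))
     = r\<^sup>2 * v * P * D * (d * \<theta>) - (c * D) * (g * \<theta>) + t * D * (d * \<theta>) + (1 - r) * v * r * P * D * \<theta>"
    by algebra
  also have "\<dots> = r\<^sup>2 * v * P * D * (x * (1 + x) * X) - r\<^sup>2 * v * P * (t * (1 - r) + x\<^sup>2 * X) * (D + x * D')
       + t * D * (x * (1 + x) * X) + (1 - r) * v * r * P * D * (1 + x * (D' + X))"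
    by (simp only: d g c, simp only: th)
  \<comment> \<open>The subtracted part is a combination of the defects of \<open>R2\<close>,
    \<open>K\<close> and \<open>t\<close>, all of them zero.\<close>
  also have "\<dots> = t * (x * (1 + x) * X) * ((1 + r * P) * D - x\<^sup>2 * P * D')
      - (x * (r * P * D - x\<^sup>2 * P * D') * (t * (1 + x) * X - v * (X + (1 - r) * (t + (1 + r * P) * D')))
         + v * P * (x * (1 - r) * D' * (x\<^sup>2 * X * (1 + r) * (-1) + (r - x + r\<^sup>2 * P * D - x\<^sup>2 * (1 + r * P) * D'))
         + (1 - r) * (x * (r - x) * D' + r * D) * (t * (r + x) - 1)))"
    by (simp add: algebra_simps power2_eq_square)
  also have "\<dots> = t * (x * (1 + x) * X) * ((1 + r * P) * D - x\<^sup>2 * P * D')"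
    using K R2 t by simp
  also have "\<dots> = \<theta> * (t * d * ((1 + r * P) * D - x\<^sup>2 * P * D'))"
    unfolding d[symmetric] by algebra
  finally show ?thesis using pos by simp
qed


text \<open>The last two claims make the remaining form degenerate: multiplied by
  \<open>x * D' * \<theta>\<close>, it is \<open>e2\<close> times the square of
  \<open>\<theta> *\<^sub>R W + (x * D') *\<^sub>R \<eta>\<close>.\<close>

lemma step_forms:
  fixes r x t v S P X D D' \<theta> \<omega> d g c c' :: real
  assumes pos: "r > 0" "x > 0" "v > 0" "P \<ge> 0" "X > 0" "D' \<ge> 0"
    and t: "t * (r + x) = 1" and vS: "(1 - r) * S = 1 - v"
    and R1: "X * (v + (1 + x) * S) = v * (1 + (1 + r * P) * (r + x) * D')"
    and R0: "x\<^sup>2 * X * (r\<^sup>2 * v + (1 + x) * (S + v * (1 + r))) = r\<^sup>2 * v * (1 + P * (r + x) * D)"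
    and th: "\<theta> = 1 + x * (D' + X)" and d: "d = x * (1 + x) * X / \<theta>"
    and om: "\<omega> = (1 - D - x\<^sup>2 * X) / \<theta>" and g: "g = 1 - \<omega> - d"
    and kh: "x\<^sup>2 * P * D' \<le> (1 + r * P) * D"
    and D: "D > 0 \<or> D = 0 \<and> P = 0"
    and c: "c = r\<^sup>2 * v * P * (t * (1 - r) + x\<^sup>2 * X) / D"
  defines "e1 \<equiv> c' - c + (1 - r) * v * (1 + 2 * r * P)"
    and "e2 \<equiv> r\<^sup>2 * v * P * d - c * g + d * t + (1 - r) * v * (r * P)"
    and "e3 \<equiv> 2 * d * t - (t + S + v * (1 + r)) * d\<^sup>2 + 2 * r\<^sup>2 * v * P * d * g - c * g\<^sup>2 - (1 - r) * v"
  shows "d > 0" and "d * (S + v * (1 + r)) = r * v + r\<^sup>2 * v * P * g"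
    and "e2 \<ge> 0" and "\<theta> * e3 = x * D' * e2"
    and "c' * D' = v * (1 + r * P) * (t * (1 - r) + X) \<Longrightarrow> x * D' * e1 = \<theta> * e2"
proof -
  note rel = step_relations[OF pos(1-3) t vS R1 R0]
  have th0: "\<theta> > 0"
    using pos by (simp add: th add_pos_nonneg)
  have t0: "t > 0"
    using t pos by (metis add_pos_pos zero_less_mult_pos2 zero_less_one)
  show d0: "d > 0"
    using pos th0 by (simp add: d)
  have d': "d * \<theta> = x * (1 + x) * X" and om': "\<omega> * \<theta> = 1 - D - x\<^sup>2 * X"
    using th0 by (simp_all add: d om)
  have g': "g * \<theta> = D + x * D'"
    using d' om' by (simp add: g algebra_simps th power2_eq_square)
  have "\<theta> * (d * (S + v * (1 + r))) = \<theta> * (r * v + r\<^sup>2 * v * P * g)"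
    using rel(3) d' g' th by algebra
  then show E: "d * (S + v * (1 + r)) = r * v + r\<^sup>2 * v * P * g"
    using th0 by simp
  have c0: "c * D = r\<^sup>2 * v * P * (t * (1 - r) + x\<^sup>2 * X)"
    using D by (auto simp: c)
  have De2: "D * e2 = t * d * ((1 + r * P) * D - x\<^sup>2 * P * D')"
    unfolding e2_def by (rule step_coefficients[OF t pos(1,2) _ rel(1,2) th d' g' c0]) (use th0 in simp)
  have P0: "D = 0 \<Longrightarrow> e2 = d * t"
    using D by (auto simp: e2_def c)
  show e2: "e2 \<ge> 0"
  proof (cases "D = 0")
    case False
    then have "D > 0" using D by auto
    moreover have "D * e2 \<ge> 0" using De2 kh t0 d0 by simp
    ultimately show ?thesis by (simp add: zero_le_mult_iff)
  qed (use P0 t0 d0 in simp)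
  \<comment> \<open>The combination \<open>e3 - g * e2\<close> is free of \<open>c\<close>, so no
    division by \<open>D\<close> enters.\<close>
  have "r * (e3 - g * e2) = d * t * (\<omega> * r - x)"
  proof -
    have "e3 - g * e2 = 2 * d * t - d * (t * d + d * (S + v * (1 + r))) + r\<^sup>2 * v * P * d * g - d * t * g
        - (1 - r) * v * (1 + r * P * g)"
      unfolding e3_def e2_def by (simp add: algebra_simps power2_eq_square)
    then have "r * (e3 - g * e2) = d * (r * t * (1 + \<omega>) - r * (r * v) - (1 - r) * (S + v * (1 + r)))"
      using E unfolding g by algebra
    also have "(1 - r) * (S + v * (1 + r)) = 1 - r * (r * v)"
      using vS by (simp add: algebra_simps power2_eq_square)
    finally show ?thesis
      using t by algebra
  qed
  then have "r * (\<theta> * e3) = r * (x * D' * e2)"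
    using g' om' De2 rel(1) th by algebra
  then show "\<theta> * e3 = x * D' * e2"
    using pos by simp
  assume c': "c' * D' = v * (1 + r * P) * (t * (1 - r) + X)"
  show "x * D' * e1 = \<theta> * e2"
  proof (cases "D = 0")
    \<comment> \<open>In the application this is \<open>j = 0\<close>; division by zero gives
      \<open>c = 0\<close>.\<close>
    case True
    then have "P = 0" "c = 0" using D by (auto simp: c)
    then have "D' * e1 = t * (1 + x) * X"
      using c' rel(2) unfolding e1_def by algebra
    then show ?thesis
      using P0[OF True] d' by algebra
  next
    case False
    have "D * (D' * e1) = D * (c' * D') - D' * (c * D) + (1 - r) * v * (1 + 2 * r * P) * (D * D')"
      unfolding e1_def by algebra
    also have "\<dots> = t * (1 + x) * X * ((1 + r * P) * D - x\<^sup>2 * P * D')"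
      unfolding c' c0 rel(2) using rel(1) t by algebra
    finally have "D * (x * D' * e1) = D * (\<theta> * e2)"
      using De2 d' by algebra
    then show ?thesis using False by simp
  qed
qed

lemma bound_step_le:
  fixes a Z W \<eta> :: "'a::real_inner" and r x t v S P X D D' \<theta> \<omega> d g c c' :: real
  assumes pos: "r > 0" "x > 0" "v > 0" "P \<ge> 0" "X > 0" "D' \<ge> 0"
    and t: "t * (r + x) = 1" and vS: "(1 - r) * S = 1 - v"
    and R1: "X * (v + (1 + x) * S) = v * (1 + (1 + r * P) * (r + x) * D')"
    and R0: "x\<^sup>2 * X * (r\<^sup>2 * v + (1 + x) * (S + v * (1 + r))) = r\<^sup>2 * v * (1 + P * (r + x) * D)"
    and th: "\<theta> = 1 + x * (D' + X)" and d: "d = x * (1 + x) * X / \<theta>"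
    and om: "\<omega> = (1 - D - x\<^sup>2 * X) / \<theta>" and g: "g = 1 - \<omega> - d"
    and kh: "x\<^sup>2 * P * D' \<le> (1 + r * P) * D"
    and D: "D > 0 \<or> D = 0 \<and> P = 0"
    and c: "c = r\<^sup>2 * v * P * (t * (1 - r) + x\<^sup>2 * X) / D"
    and c': "c' = v * (1 + r * P) * (t * (1 - r) + X) / D'"
    and W: "D' = 0 \<Longrightarrow> W = 0"
  shows "bound r t v (1 + r * P) S c' (r *\<^sub>R a - (Z + W + \<eta>)) Z W + 2 * d * inner (a - t *\<^sub>R (Z + W + \<eta>)) \<eta>
    \<le> bound r t (r\<^sup>2 * v) P (S + v * (1 + r)) c a (Z + d *\<^sub>R \<eta>) (W + g *\<^sub>R \<eta>)"
proof -
  note F = step_forms(1-4)[OF pos t vS R1 R0 th d om g kh D c]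
    step_forms(5)[OF pos t vS R1 R0 th d om g kh D c, of c']
  define e1 e2 e3 where "e1 = c' - c + (1 - r) * v * (1 + 2 * r * P)"
    and "e2 = r\<^sup>2 * v * P * d - c * g + d * t + (1 - r) * v * (r * P)"
    and "e3 = 2 * d * t - (t + S + v * (1 + r)) * d\<^sup>2 + 2 * r\<^sup>2 * v * P * d * g - c * g\<^sup>2 - (1 - r) * v"
  note F = F[folded e1_def e2_def e3_def]
  have th0: "\<theta> > 0"
    using pos by (simp add: th add_pos_nonneg)
  have "0 \<le> e1 * inner W W + 2 * e2 * inner W \<eta> + e3 * inner \<eta> \<eta>"
  proof (cases "D' = 0")
    \<comment> \<open>In the application this is \<open>j + 1 = N\<close>, where average and balance
      coincide and the slack vanishes.\<close>
    case True
    then have "e3 = 0" "W = 0" using F(4) th0 W by auto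
    then show ?thesis by simp
  next
    case False
    then have D': "D' > 0" using pos by simp
    then have e1: "x * D' * e1 = \<theta> * e2" using F(5) by (simp add: c')
    let ?k = "x * D'"
    have "?k * \<theta> * (e1 * inner W W + 2 * e2 * inner W \<eta> + e3 * inner \<eta> \<eta>)
       = \<theta> * (?k * e1) * inner W W + 2 * ?k * \<theta> * e2 * inner W \<eta> + ?k * (\<theta> * e3) * inner \<eta> \<eta>"
      by (simp add: algebra_simps)
    also have "\<dots> = e2 * inner (\<theta> *\<^sub>R W + ?k *\<^sub>R \<eta>) (\<theta> *\<^sub>R W + ?k *\<^sub>R \<eta>)"
      unfolding e1 F(4) by (simp add: inner_add_left inner_add_right inner_commute[of \<eta> W] algebra_simps)
    also have "\<dots> \<ge> 0" using F(3) by simp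
    finally have "0 \<le> ?k * \<theta> * (e1 * inner W W + 2 * e2 * inner W \<eta> + e3 * inner \<eta> \<eta>)" .
    moreover have "0 < ?k * \<theta>" using D' pos th0 by simp
    ultimately show ?thesis by (meson not_le mult_pos_neg)
  qed
  then show ?thesis
    using bound_step[OF vS F(2), of t c a Z \<eta> W c'] unfolding e1_def e2_def e3_def by linarith
qed

section \<open>The weights at the threshold\<close>

text \<open>The equation says that \<open>x ^ (2 * N)\<close> equals the sublinear rate for \<open>\<gamma> L = 1 + x\<close>.\<close>

locale threshold =
  fixes r x :: real and N :: nat
  assumes r: "r > 0" and x: "x > 0" and N: "N > 0"
    and threshold: "x ^ (2 * N) * (r ^ (2 * N) + (1 + x) * geo r (2 * N)) = r ^ (2 * N)"
begin

text \<open>The definitions are forced by requiring that the two extremal functions make every step of the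
  backward summation tight. For the quadratic one, where \<open>y\<^sub>i = (- x) ^ (i - j)\<close>, the two carried
  combinations are \<open>bal y j = xpow j\<close> and \<open>avg y j = xpow j + gap j\<close> if \<open>0 < j\<close>. By division by zero
  \<open>gap 0 = quad 0 = 0\<close> and \<open>quad N = 0\<close>; these values are harmless, because \<open>geo r 0 = 0\<close> and
  \<open>avg y N = bal y N\<close>.\<close>

definition "rpow j = r ^ (2 * (N - j))"
definition "gsum j = geo r (2 * (N - j))"
definition "xpow j = x ^ (2 * (N - j))"
definition "gap j = (xpow j * (rpow j + (1 + x) * gsum j) - rpow j) / (rpow j * geo r j * (r + x))"
definition "den j = 1 + x * (gap (Suc j) + xpow (Suc j))"
definition "mix j = (1 - gap j - xpow j) / den j"
definition "gain j = x * (1 + x) * xpow (Suc j) / den j"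
definition "tau = 1 / (r + x)"
definition "quad j = rpow j * geo r j * (tau * (1 - r) + xpow j) / gap j"

lemma rpow_pos: "rpow j > 0" and xpow_pos: "xpow j > 0" and gsum_nonneg: "gsum j \<ge> 0"
  using r x by (simp_all add: rpow_def xpow_def gsum_def geo_nonneg)

lemma rpow_gsum: "(1 - r) * gsum j = 1 - rpow j"
  by (simp add: gsum_def rpow_def geo_mult)

lemma Suc_simps:
  assumes "j < N"
  shows "rpow j = r\<^sup>2 * rpow (Suc j)" "xpow j = x\<^sup>2 * xpow (Suc j)" "gsum j = gsum (Suc j) + rpow (Suc j) * (1 + r)"
    "geo r (Suc j) = 1 + r * geo r j"
proof -
  have *: "2 * (N - j) = 2 * (N - Suc j) + 2" using assms by simp
  show "rpow j = r\<^sup>2 * rpow (Suc j)" "xpow j = x\<^sup>2 * xpow (Suc j)"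
    unfolding rpow_def xpow_def * by (simp_all add: power_add power2_eq_square)
  show "gsum j = gsum (Suc j) + rpow (Suc j) * (1 + r)"
    unfolding gsum_def rpow_def * geo_add[of r _ 2] by (simp add: numeral_2_eq_2 geo_Suc)
  show "geo r (Suc j) = 1 + r * geo r j" by (rule geo_Suc)
qed

lemma x2N_less_1: "x ^ (2 * N) < 1"
proof -
  have "0 < x ^ (2 * N) * ((1 + x) * geo r (2 * N))"
    using r x N by (simp add: geo_pos)
  then have "x ^ (2 * N) * r ^ (2 * N) < 1 * r ^ (2 * N)"
    using threshold by (simp add: algebra_simps)
  then show ?thesis using r by simp
qed

lemma x_less_1: "x < 1"
  using x2N_less_1 x by (meson not_le one_le_power)

lemma x_less_r: "x < r"
proof -
  have "geo r (2 * N) = 1 + r * geo r (2 * N - 1)"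
    using geo_Suc[of r "2 * N - 1"] N by simp
  then have "1 \<le> geo r (2 * N)" using r by (simp add: geo_nonneg)
  then have "1 * 1 \<le> (1 + x) * geo r (2 * N)"
    using x by (intro mult_mono) auto
  moreover have "0 < r ^ (2 * N)" using r by simp
  ultimately have "1 < r ^ (2 * N) + (1 + x) * geo r (2 * N)" by linarith
  then have "x ^ (2 * N) * 1 < x ^ (2 * N) * (r ^ (2 * N) + (1 + x) * geo r (2 * N))"
    using x by (intro mult_strict_left_mono) simp_all
  then have "x ^ (2 * N) < r ^ (2 * N)" unfolding threshold by simp
  then show ?thesis using r by (meson less_imp_le power_less_imp_less_base)
qed

lemma tau: "tau * (r + x) = 1"
  using r x by (simp add: tau_def)

lemma threshold_geo: "(1 + x) * x ^ (2 * N) * geo r (2 * N) = r ^ (2 * N) * (1 - x ^ (2 * N))"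
    "(r + x) * x ^ (2 * N) * geo r (2 * N) = r ^ (2 * N) - x ^ (2 * N)"
proof -
  show 1: "(1 + x) * x ^ (2 * N) * geo r (2 * N) = r ^ (2 * N) * (1 - x ^ (2 * N))"
    using threshold by (simp add: algebra_simps)
  have "x ^ (2 * N) * ((1 - r) * geo r (2 * N)) = x ^ (2 * N) * (1 - r ^ (2 * N))" by (simp only: geo_mult)
  then show "(r + x) * x ^ (2 * N) * geo r (2 * N) = r ^ (2 * N) - x ^ (2 * N)"
    using 1 by (simp add: algebra_simps)
qed

text \<open>The definition of \<open>gap\<close> without the division. At \<open>j = 0\<close> the
  term with \<open>gap\<close> drops out since \<open>geo r 0 = 0\<close>, and what remains is
  exactly the threshold equation.\<close>

lemma gap_eq:
  assumes "j \<le> N"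
  shows "rpow j * (1 + geo r j * (r + x) * gap j) = xpow j * (rpow j + (1 + x) * gsum j)"
proof (cases "j = 0")
  case True
  then show ?thesis
    using threshold by (simp add: rpow_def xpow_def gsum_def)
next
  case False
  then have "geo r j > 0" using r by (simp add: geo_pos)
  then have "rpow j * geo r j * (r + x) \<noteq> 0"
    using rpow_pos[of j] r x by simp
  then have "gap j * (rpow j * geo r j * (r + x)) = xpow j * (rpow j + (1 + x) * gsum j) - rpow j"
    unfolding gap_def by simp
  then show ?thesis by (simp add: algebra_simps)
qed

lemma gap_N: "gap N = 0" and gap_0: "gap 0 = 0"
  by (simp_all add: gap_def rpow_def xpow_def gsum_def)

section \<open>Signs and monotonicity of the gaps\<close>

context
  fixes j n assumes jn: "j + n = N"
begin

lemma split: "x ^ (2 * N) = xpow j * x ^ (2 * j)" "r ^ (2 * N) = rpow j * r ^ (2 * j)"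
    "geo r (2 * N) = geo r (2 * j) + r ^ (2 * j) * gsum j"
proof -
  have *: "2 * N = 2 * j + 2 * n" "N - j = n" using jn by auto
  show "x ^ (2 * N) = xpow j * x ^ (2 * j)" "r ^ (2 * N) = rpow j * r ^ (2 * j)"
    "geo r (2 * N) = geo r (2 * j) + r ^ (2 * j) * gsum j"
    unfolding xpow_def rpow_def gsum_def * by (simp_all only: power_add geo_add mult.commute)
qed

text \<open>The threshold equation eliminates the factor \<open>1 + x\<close>. For
  \<open>0 < j\<close> the sign of \<open>gap j\<close> then comes from comparing
  \<open>geo r (2 * k) / (1 - x ^ (2 * k))\<close> at \<open>k = j\<close> and at
  \<open>k = N\<close>.\<close>

lemma gap_scaled:
  "geo r j * (r + x) * (x ^ (2 * N) * geo r (2 * N)) * gap j =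
    xpow j * (geo r (2 * N) * (1 - x ^ (2 * j)) - (1 - x ^ (2 * N)) * geo r (2 * j))"
proof -
  have gap_eq': "rpow j * (geo r j * (r + x) * gap j) = xpow j * (rpow j + (1 + x) * gsum j) - rpow j"
    using gap_eq[of j] jn by (simp add: algebra_simps)
  have "rpow j * (geo r j * (r + x) * (x ^ (2 * N) * geo r (2 * N)) * gap j) =
     (xpow j * (rpow j + (1 + x) * gsum j) - rpow j) * (x ^ (2 * N) * geo r (2 * N))"
    unfolding gap_eq'[symmetric] by (simp add: algebra_simps)
  also have "\<dots> = xpow j * (rpow j * (x ^ (2 * N) * geo r (2 * N)) + (r ^ (2 * N) * (1 - x ^ (2 * N))) * gsum j)
      - rpow j * (x ^ (2 * N) * geo r (2 * N))"
    unfolding threshold_geo(1)[symmetric] by (simp add: algebra_simps)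
  also have "\<dots> = rpow j * (xpow j * (geo r (2 * N) * (1 - x ^ (2 * j)) - (1 - x ^ (2 * N)) * geo r (2 * j)))"
    unfolding split by (simp add: algebra_simps)
  finally show ?thesis using rpow_pos[of j] by simp
qed

end

text \<open>Up to constant factors both expressions are geometric sums with bases
  \<open>x\<^sup>2 < r\<^sup>2\<close>, so \<open>geo_quotient_less\<close> applies.\<close>

lemma geo_quotient:
  assumes "0 < m" "m \<le> n"
  shows "(1 - x ^ (2 * n)) * geo r (2 * m) \<le> (1 - x ^ (2 * m)) * geo r (2 * n)"
    and "m < n \<Longrightarrow> (1 - x ^ (2 * n)) * geo r (2 * m) < (1 - x ^ (2 * m)) * geo r (2 * n)"
proof -
  have y: "0 < x\<^sup>2" "x\<^sup>2 < r\<^sup>2" "x\<^sup>2 < 1"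
    using x x_less_r x_less_1 by (simp_all add: power_strict_mono power_less_one_iff)
  have e: "1 - x ^ (2 * k) = (1 - x\<^sup>2) * geo (x\<^sup>2) k" for k
    by (simp add: geo_mult power_mult)
  have l: "(1 - x ^ (2 * n)) * geo r (2 * m) < (1 - x ^ (2 * m)) * geo r (2 * n)" if "m < n"
  proof -
    have "((1 - x\<^sup>2) * (1 + r)) * (geo (x\<^sup>2) n * geo (r\<^sup>2) m) < ((1 - x\<^sup>2) * (1 + r)) * (geo (x\<^sup>2) m * geo (r\<^sup>2) n)"
      using geo_quotient_less[OF y(1,2) assms(1) that] y r by (intro mult_strict_left_mono) auto
    then show ?thesis unfolding e geo_even by (simp add: mult_ac)
  qed
  then show "m < n \<Longrightarrow> (1 - x ^ (2 * n)) * geo r (2 * m) < (1 - x ^ (2 * m)) * geo r (2 * n)" .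
  show "(1 - x ^ (2 * n)) * geo r (2 * m) \<le> (1 - x ^ (2 * m)) * geo r (2 * n)"
    using l assms by (cases "m = n") auto
qed

lemma K_pos: "(r + x) * (x ^ (2 * N) * geo r (2 * N)) > 0"
  using r x N by (simp add: geo_pos)

lemma gap_pos:
  assumes "0 < j" "j < N"
  shows "gap j > 0"
proof -
  have "0 < xpow j * (geo r (2 * N) * (1 - x ^ (2 * j)) - (1 - x ^ (2 * N)) * geo r (2 * j))"
    using geo_quotient(2)[of j N] assms xpow_pos[of j] by (simp add: mult.commute)
  also have "\<dots> = (geo r j * ((r + x) * (x ^ (2 * N) * geo r (2 * N)))) * gap j"
    using gap_scaled[of j "N - j"] assms by (simp add: mult_ac)
  finally have "0 < (geo r j * ((r + x) * (x ^ (2 * N) * geo r (2 * N)))) * gap j" .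
  moreover have "0 < geo r j * ((r + x) * (x ^ (2 * N) * geo r (2 * N)))"
    using K_pos geo_pos[OF r assms(1)] by (rule mult_pos_pos[rotated])
  ultimately show ?thesis by (rule zero_less_mult_pos)
qed

lemma gap_nonneg: "j \<le> N \<Longrightarrow> gap j \<ge> 0"
  using gap_pos[of j] gap_0 gap_N by (cases "j = 0 \<or> j = N") auto

text \<open>This is \<open>kh\<close> of \<open>step_forms\<close>, which makes the slack
  nonnegative. After scaling by \<open>gap_scaled\<close>, the difference of the two sides is a
  positive combination of \<open>geo_quotient\<close> for \<open>j, Suc j\<close> and for
  \<open>Suc j, N\<close>.\<close>

lemma gap_quotient:
  assumes j: "j < N"
  shows "x\<^sup>2 * geo r j * gap (Suc j) \<le> (1 + r * geo r j) * gap j"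
proof (cases "j = 0")
  case False
  define P P' e W Y Y' B where "P = geo r j" and "P' = geo r (Suc j)" and "e = r ^ j"
    and "W = geo r (2 * N)" and "Y = 1 - x ^ (2 * j)" and "Y' = 1 - x ^ (2 * Suc j)" and "B = 1 - x ^ (2 * N)"
  define K where "K = (r + x) * (x ^ (2 * N) * geo r (2 * N))"
  have P: "P > 0" "P' > 0" and e: "e > 0" and W: "W > 0"
    using False r j by (simp_all add: P_def P'_def e_def W_def geo_pos)
  have P': "P' = P + e" "P' = 1 + r * P" and re: "r ^ Suc j = r * e"
    using geo_add[of r j 1] by (simp_all add: P_def P'_def geo_Suc e_def)
  have q: "geo r (2 * j) = P * (1 + e)" "geo r (2 * Suc j) = P' * (1 + r * e)"
    unfolding geo_even_mult P_def P'_def e_def by simp_all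
  have YY': "Y' * (P * (1 + e)) \<le> Y * (P' * (1 + r * e))"
    using geo_quotient(1)[of j "Suc j"] False unfolding q Y_def Y'_def by simp
  have Y'B: "B * (P' * (1 + r * e)) \<le> Y' * W"
    using geo_quotient(1)[of "Suc j" N] j unfolding q Y'_def B_def W_def by simp
  have red: "P' * (1 + e) - P * (1 + r * e) = 2 * e"
    using P' by algebra
  have "(1 + r * e) * (P\<^sup>2 * (W * Y' - B * (P' * (1 + r * e)))) \<le> (1 + r * e) * (P'\<^sup>2 * (W * Y - B * (P * (1 + e))))"
  proof -
    have "0 \<le> W * P' * (Y * (P' * (1 + r * e)) - Y' * (P * (1 + e)))"
      using YY' W P by simp
    moreover have "0 \<le> 2 * e * P * (Y' * W - B * (P' * (1 + r * e)))"
      using Y'B e P by simp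
    moreover have "(1 + r * e) * (P'\<^sup>2 * (W * Y - B * (P * (1 + e)))) - (1 + r * e) * (P\<^sup>2 * (W * Y' - B * (P' * (1 + r * e))))
      = W * P' * (Y * (P' * (1 + r * e)) - Y' * (P * (1 + e))) + 2 * e * P * (Y' * W - B * (P' * (1 + r * e)))"
      unfolding red[symmetric] by algebra
    ultimately show ?thesis by linarith
  qed
  moreover have "1 + r * e > 0" using r e by (simp add: add_pos_pos)
  ultimately have main: "P\<^sup>2 * (W * Y' - B * (P' * (1 + r * e))) \<le> P'\<^sup>2 * (W * Y - B * (P * (1 + e)))"
    by (simp only: mult_le_cancel_left_pos)
  have D: "P * K * gap j = x\<^sup>2 * xpow (Suc j) * (W * Y - B * (P * (1 + e)))"
    using gap_scaled[of j "N - j"] j unfolding q Suc_simps(2)[OF j]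
    unfolding P_def K_def W_def Y_def B_def by (simp add: mult_ac)
  have D': "P' * K * gap (Suc j) = xpow (Suc j) * (W * Y' - B * (P' * (1 + r * e)))"
    using gap_scaled[of "Suc j" "N - Suc j"] j unfolding q
    unfolding P'_def K_def W_def Y'_def B_def by (simp add: mult_ac)
  have "P * P' * K * (x\<^sup>2 * P * gap (Suc j)) = x\<^sup>2 * xpow (Suc j) * (P\<^sup>2 * (W * Y' - B * (P' * (1 + r * e))))"
    using D' by algebra
  also have "\<dots> \<le> x\<^sup>2 * xpow (Suc j) * (P'\<^sup>2 * (W * Y - B * (P * (1 + e))))"
    using main xpow_pos[of "Suc j"] by (intro mult_left_mono) auto
  also have "\<dots> = P * P' * K * (P' * gap j)"
    using D by algebra
  finally have "x\<^sup>2 * P * gap (Suc j) \<le> P' * gap j"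
    using P K_pos by (simp add: K_def mult_le_cancel_left_pos)
  then show ?thesis using P' by (simp add: P_def)
qed (simp add: gap_0)

text \<open>Needed for \<open>mix j \<ge> 0\<close>. For \<open>0 < j\<close> the difference is, up
  to positive factors, the slack of \<open>geo_shift_scaled\<close>; \<open>comm\<close> splits
  \<open>geo r (j + 2 * n)\<close> in two ways.\<close>

lemma gap_xpow_le:
  assumes j: "j < N"
  shows "gap j + xpow j \<le> 1"
proof (cases "j = 0")
  case True
  then show ?thesis using x2N_less_1 by (simp add: gap_0 xpow_def)
next
  case False
  define n where "n = N - j"
  have jn: "j + n = N" using j by (simp add: n_def)
  define P e v S X Y where "P = geo r j" and "e = r ^ j" and "v = rpow j" and "S = gsum j" and "X = xpow j"
    and "Y = x ^ (2 * j)"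
  have P: "P > 0" and e: "e > 0" using False r by (simp_all add: P_def e_def geo_pos)
  have xn: "X = x ^ (2 * n)" and vn: "v = r ^ (2 * n)" and Sn: "S = geo r (2 * n)"
    by (simp_all add: X_def xpow_def n_def v_def rpow_def S_def gsum_def)
  have comm: "S + v * P = P + e * S"
    using geo_add[of r "2 * n" j] geo_add[of r j "2 * n"] by (simp add: add.commute Sn vn P_def e_def)
  have F: "X * (S + v * P) * (e - Y) \<le> P * (v * e - X\<^sup>2 * Y)"
    using geo_shift_scaled[OF r x x_less_r x_less_1, of n j] geo_add[of r "2 * n" j]
    by (simp add: xn Sn vn P_def e_def Y_def power_add power_mult[symmetric] mult_ac add.commute)
  have yN: "x ^ (2 * N) = X * Y" and A: "r ^ (2 * N) = v * e\<^sup>2" and W: "geo r (2 * N) = P * (1 + e) + e\<^sup>2 * S"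
    and q: "geo r (2 * j) = P * (1 + e)"
    unfolding split[OF jn] X_def Y_def v_def e_def S_def P_def geo_even_mult[of r j] power_even_eq[symmetric] by simp_all
  have K: "(r + x) * (x ^ (2 * N) * geo r (2 * N)) = v * e\<^sup>2 - X * Y"
    using threshold_geo(2) unfolding yN A by (simp add: mult.assoc)
  have "P * ((r + x) * (x ^ (2 * N) * geo r (2 * N))) * gap j =
      X * (geo r (2 * N) * (1 - Y) - (1 - x ^ (2 * N)) * geo r (2 * j))"
    using gap_scaled[OF jn] by (simp add: P_def X_def Y_def mult.assoc)
  then have "P * (v * e\<^sup>2 - X * Y) * gap j = X * (geo r (2 * N) * (1 - Y) - (1 - x ^ (2 * N)) * geo r (2 * j))"
    unfolding K .
  then have "P * (v * e\<^sup>2 - X * Y) * gap j = X * ((P * (1 + e) + e\<^sup>2 * S) * (1 - Y) - (1 - X * Y) * (P * (1 + e)))"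
    unfolding W q yN .
  then have "P * (v * e\<^sup>2 - X * Y) * (1 - gap j - X) = e * (P * (v * e - X\<^sup>2 * Y) - X * (S + v * P) * (e - Y))"
    using comm by algebra
  also have "\<dots> \<ge> 0" using F e by simp
  finally have "0 \<le> P * (v * e\<^sup>2 - X * Y) * (1 - gap j - X)" .
  moreover have "P * (v * e\<^sup>2 - X * Y) > 0" using K K_pos P by simp
  ultimately have "0 \<le> 1 - gap j - X" by (meson not_le mult_pos_neg)
  then show ?thesis by (simp add: X_def)
qed

lemma den_ge_1: "j < N \<Longrightarrow> den j \<ge> 1"
  using gap_nonneg[of "Suc j"] xpow_pos[of "Suc j"] x by (simp add: den_def)

lemma mix_bounds: "j < N \<Longrightarrow> 0 \<le> mix j" "j < N \<Longrightarrow> mix j \<le> 1"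
  using den_ge_1[of j] gap_xpow_le[of j] gap_nonneg[of j] xpow_pos[of j] by (auto simp: mix_def)

lemma rpow_gsum_Suc: "j < N \<Longrightarrow> gsum (Suc j) + rpow (Suc j) = 1 + r * gsum (Suc j)"
  using rpow_gsum[of "Suc j"] by (simp add: algebra_simps)

text \<open>Supplies the hypotheses of \<open>step_forms\<close> and \<open>bound_step_le\<close>,
  with \<open>v = rpow (Suc j)\<close>, \<open>S = gsum (Suc j)\<close> and
  \<open>P = geo r j\<close>.\<close>

lemma step_facts:
  assumes j: "j < N"
  shows "rpow (Suc j) > 0" "geo r j \<ge> 0" "xpow (Suc j) > 0" "gap (Suc j) \<ge> 0"
    "(1 - r) * gsum (Suc j) = 1 - rpow (Suc j)"
    "xpow (Suc j) * (rpow (Suc j) + (1 + x) * gsum (Suc j)) =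
       rpow (Suc j) * (1 + (1 + r * geo r j) * (r + x) * gap (Suc j))"
    "x\<^sup>2 * xpow (Suc j) * (r\<^sup>2 * rpow (Suc j) + (1 + x) * (gsum (Suc j) + rpow (Suc j) * (1 + r))) =
       r\<^sup>2 * rpow (Suc j) * (1 + geo r j * (r + x) * gap j)"
    "den j = 1 + x * (gap (Suc j) + xpow (Suc j))" "gain j = x * (1 + x) * xpow (Suc j) / den j"
    "mix j = (1 - gap j - x\<^sup>2 * xpow (Suc j)) / den j"
    "x\<^sup>2 * geo r j * gap (Suc j) \<le> (1 + r * geo r j) * gap j"
    "gap j > 0 \<or> gap j = 0 \<and> geo r j = 0"
    "quad j = r\<^sup>2 * rpow (Suc j) * geo r j * (tau * (1 - r) + x\<^sup>2 * xpow (Suc j)) / gap j"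
proof -
  note S = Suc_simps[OF j]
  show "rpow (Suc j) > 0" "geo r j \<ge> 0" "xpow (Suc j) > 0" "gap (Suc j) \<ge> 0"
    using rpow_pos r xpow_pos gap_nonneg[of "Suc j"] j by (simp_all add: geo_nonneg)
  show "(1 - r) * gsum (Suc j) = 1 - rpow (Suc j)" by (rule rpow_gsum)
  show "xpow (Suc j) * (rpow (Suc j) + (1 + x) * gsum (Suc j)) =
       rpow (Suc j) * (1 + (1 + r * geo r j) * (r + x) * gap (Suc j))"
    using gap_eq[of "Suc j"] j unfolding S(4) by simp
  show "x\<^sup>2 * xpow (Suc j) * (r\<^sup>2 * rpow (Suc j) + (1 + x) * (gsum (Suc j) + rpow (Suc j) * (1 + r))) =
       r\<^sup>2 * rpow (Suc j) * (1 + geo r j * (r + x) * gap j)"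
    using gap_eq[of j] j unfolding S(1-3) by simp
  show "den j = 1 + x * (gap (Suc j) + xpow (Suc j))" "gain j = x * (1 + x) * xpow (Suc j) / den j"
    by (simp_all only: den_def gain_def)
  show "mix j = (1 - gap j - x\<^sup>2 * xpow (Suc j)) / den j"
    "quad j = r\<^sup>2 * rpow (Suc j) * geo r j * (tau * (1 - r) + x\<^sup>2 * xpow (Suc j)) / gap j"
    by (simp_all only: mix_def quad_def S(1,2))
  show "x\<^sup>2 * geo r j * gap (Suc j) \<le> (1 + r * geo r j) * gap j" by (rule gap_quotient[OF j])
  show "gap j > 0 \<or> gap j = 0 \<and> geo r j = 0"
    using gap_pos[of j] gap_0 j by (cases "j = 0") auto
qed

lemma gain_pos: "j < N \<Longrightarrow> gain j > 0"
  and gain_eq: "j < N \<Longrightarrow> gain j * (gsum j + rpow j * geo r j) = r * rpow (Suc j) + rpow j * geo r j * (1 - mix j)"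
proof -
  assume j: "j < N"
  note F = step_forms(1,2)[OF r x step_facts(1-4)[OF j] tau step_facts(5-10)[OF j] refl step_facts(11-13)[OF j]]
  show "gain j > 0" by (rule F(1))
  show "gain j * (gsum j + rpow j * geo r j) = r * rpow (Suc j) + rpow j * geo r j * (1 - mix j)"
    using F(2) unfolding Suc_simps[OF j] by algebra
qed

section \<open>The backward recursion\<close>

primrec avg_from_end :: "(nat \<Rightarrow> 'b::real_vector) \<Rightarrow> nat \<Rightarrow> 'b" where
  "avg_from_end s 0 = s N"
| "avg_from_end s (Suc n) = mix (N - Suc n) *\<^sub>R avg_from_end s n + (1 - mix (N - Suc n)) *\<^sub>R s (N - Suc n)"

text \<open>The increment is the difference of the \<open>e\<close>-terms in the averaged
  cocoercivity inequality at the new index, weighted by \<open>gain\<close>. It has total weight 0,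
  so the weights always sum to 1.\<close>

primrec bal_from_end :: "(nat \<Rightarrow> 'b::real_vector) \<Rightarrow> nat \<Rightarrow> 'b" where
  "bal_from_end s 0 = s N"
| "bal_from_end s (Suc n) = bal_from_end s n + gain (N - Suc n) *\<^sub>R (s (N - Suc n) - avg_from_end s n)"

text \<open>The recursions run downwards from \<open>N\<close> and are therefore defined on the
  distance to \<open>N\<close>.\<close>

definition "avg s j = avg_from_end s (N - j)"
definition "bal s j = bal_from_end s (N - j)"

lemma avg_N: "avg s N = s N" and bal_N: "bal s N = s N"
  by (simp_all add: avg_def bal_def)

lemma avg_step: "j < N \<Longrightarrow> avg s j = mix j *\<^sub>R avg s (Suc j) + (1 - mix j) *\<^sub>R s j"
  and bal_step: "j < N \<Longrightarrow> bal s j = bal s (Suc j) + gain j *\<^sub>R (s j - avg s (Suc j))"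
  using Suc_diff_Suc[of j N] by (auto simp: avg_def bal_def simp flip: Suc_diff_Suc)

text \<open>At \<open>j = 0\<close> this says that the weights of \<open>bal\<close> are
  nonnegative. Nonnegativity alone is too weak for the induction, because \<open>bal_step\<close>
  subtracts an average; \<open>gain_eq\<close> makes the comparison with \<open>avg\<close>
  reproduce itself.\<close>

lemma bal_ge_avg:
  fixes s :: "nat \<Rightarrow> real"
  assumes s: "\<And>k. k \<le> N \<Longrightarrow> s k \<ge> 0" and "j \<le> N"
  shows "avg s j \<ge> 0 \<and> (gsum j + rpow j * geo r j) * bal s j \<ge> rpow j * geo r j * avg s j"
  using \<open>j \<le> N\<close>
proof (induction rule: inc_induct)
  case base
  then show ?case using s r by (simp add: avg_N bal_N gsum_def rpow_def geo_nonneg)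
next
  case (step j)
  note j = step.hyps(2)
  define w where "w i = gsum i + rpow i * geo r i" for i
  have IH: "avg s (Suc j) \<ge> 0" "w (Suc j) * bal s (Suc j) \<ge> rpow (Suc j) * geo r (Suc j) * avg s (Suc j)"
    using step.IH by (simp_all add: w_def)
  have w: "w j = 1 + r * w (Suc j)" "w (Suc j) \<ge> rpow (Suc j) * geo r (Suc j)"
    using rpow_gsum_Suc[OF j] gsum_nonneg[of "Suc j"]
    by (simp_all add: w_def Suc_simps[OF j] algebra_simps power2_eq_square)
  have w0: "rpow (Suc j) * geo r (Suc j) > 0"
    using rpow_pos[of "Suc j"] geo_pos[OF r, of "Suc j"] by simp
  have bal': "bal s (Suc j) \<ge> 0"
  proof -
    have "0 \<le> w (Suc j) * bal s (Suc j)"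
      using IH w0 by (smt (verit) mult_nonneg_nonneg)
    moreover have "0 < w (Suc j)" using w w0 by linarith
    ultimately show ?thesis by (simp add: zero_le_mult_iff)
  qed
  have dw: "w j * gain j = r * rpow (Suc j) + rpow j * geo r j * (1 - mix j)"
    using gain_eq[OF j] by (simp add: w_def mult.commute)
  have "w j * bal s j = bal s (Suc j) + r * (w (Suc j) * bal s (Suc j)) + (w j * gain j) * (s j - avg s (Suc j))"
    unfolding bal_step[OF j, of s] w(1) by (simp add: algebra_simps)
  also have "\<dots> \<ge> r * (rpow (Suc j) * geo r (Suc j) * avg s (Suc j)) + (w j * gain j) * (s j - avg s (Suc j))"
    using bal' IH(2) r by (smt (verit) mult_left_mono)
  also have "r * (rpow (Suc j) * geo r (Suc j) * avg s (Suc j)) + (w j * gain j) * (s j - avg s (Suc j))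
      = rpow j * geo r j * avg s j + r * rpow (Suc j) * s j"
    unfolding dw avg_step[OF j] Suc_simps[OF j] by (simp add: algebra_simps power2_eq_square)
  finally have "w j * bal s j \<ge> rpow j * geo r j * avg s j + r * rpow (Suc j) * s j" .
  moreover have "r * rpow (Suc j) * s j \<ge> 0"
    using r rpow_pos[of "Suc j"] s[of j] j by simp
  moreover have "avg s j \<ge> 0"
    unfolding avg_step[OF j] using mix_bounds[OF j] IH s[of j] j by simp
  ultimately show ?case by (simp add: w_def)
qed

text \<open>Both combinations are linear with weights of sum 1, so constants pass through
  unchanged.\<close>

lemma avg_bal_affine:
  fixes y :: "nat \<Rightarrow> 'b::real_inner"
  assumes "j \<le> N"
  shows "avg (\<lambda>k. e k - inner (y k) p + b) j = avg e j - inner (avg y j) p + b \<and>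
    bal (\<lambda>k. e k - inner (y k) p + b) j = bal e j - inner (bal y j) p + b"
  using assms
proof (induction rule: inc_induct)
  case (step j)
  show ?case
    unfolding avg_step[OF step.hyps(2)] bal_step[OF step.hyps(2)] step.IH[THEN conjunct1] step.IH[THEN conjunct2]
    by (simp add: inner_add_left inner_diff_left algebra_simps)
qed (simp add: avg_N bal_N)

text \<open>The assumption is affine in \<open>e k\<close> and \<open>y k\<close>, and by
  \<open>mix_bounds\<close> \<open>avg\<close> is a convex combination over indices from
  \<open>m\<close> to \<open>N\<close>.\<close>

lemma avg_inequality:
  fixes y :: "nat \<Rightarrow> 'b::real_inner"
  assumes "j < m" "m \<le> N" and le: "\<And>k. j < k \<Longrightarrow> k \<le> N \<Longrightarrow> c \<le> e k + inner p (q - y k)"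
  shows "c \<le> avg e m + inner p (q - avg y m)"
  using assms(2,1)
proof (induction rule: inc_induct)
  case (step m)
  have "c = mix m * c + (1 - mix m) * c" by (simp add: algebra_simps)
  also have "\<dots> \<le> mix m * (avg e (Suc m) + inner p (q - avg y (Suc m))) + (1 - mix m) * (e m + inner p (q - y m))"
    using step mix_bounds[of m] le[of m] by (intro add_mono mult_left_mono) auto
  also have "\<dots> = avg e m + inner p (q - avg y m)"
    using step by (simp add: avg_step inner_diff_right inner_add_right algebra_simps)
  finally show ?case .
qed (use le in \<open>simp add: avg_N\<close>)

text \<open>Backward induction, with equality at \<open>j = N\<close>. Each step averages the
  inequalities between \<open>j\<close> and the later \<open>k\<close>, multiplies by
  \<open>gain j\<close> and adds \<open>bound_step_le\<close>.\<close>

lemma bound_invariant: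
  fixes a y :: "nat \<Rightarrow> 'b::real_inner" and h :: "nat \<Rightarrow> real"
  defines "e \<equiv> \<lambda>k. inner (y k) (a k) - h k - tau / 2 * inner (y k) (y k)"
  assumes rec: "\<And>k. k < N \<Longrightarrow> a (Suc k) = r *\<^sub>R a k - y k"
    and le: "\<And>j k. j < k \<Longrightarrow> k \<le> N \<Longrightarrow> e j \<le> e k + inner (a j - tau *\<^sub>R y j) (y j - y k)"
    and "j \<le> N"
  shows "2 * h N + (1 - r) * inner (a N) (a N) + 2 * bal e j \<le>
    bound r tau (rpow j) (geo r j) (gsum j) (quad j) (a j) (bal y j) (avg y j - bal y j)"
  using \<open>j \<le> N\<close>
proof (induction rule: inc_induct)
  case base
  show ?case
    by (simp add: bound_def avg_N bal_N rpow_def gsum_def e_def inner_commute[of "y N" "a N"])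
next
  case (step j)
  note j = step.hyps(2)
  define Z where "Z = bal y (Suc j)"
  define W where "W = avg y (Suc j) - Z"
  define \<eta> where "\<eta> = y j - avg y (Suc j)"
  define g where "g = 1 - mix j - gain j"
  have y: "y j = Z + W + \<eta>" and a: "a (Suc j) = r *\<^sub>R a j - (Z + W + \<eta>)"
    using rec[OF j] by (simp_all add: Z_def W_def \<eta>_def)
  have Z: "bal y j = Z + gain j *\<^sub>R \<eta>"
    by (simp add: bal_step[OF j] Z_def \<eta>_def)
  have W: "avg y j - bal y j = W + g *\<^sub>R \<eta>"
    unfolding Z avg_step[OF j] by (simp add: W_def \<eta>_def g_def algebra_simps)
  have W0: "W = 0" if "gap (Suc j) = 0"
  proof -
    have "Suc j = N"
      using gap_pos[of "Suc j"] that j by (cases "Suc j = N") auto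
    then show ?thesis by (simp add: W_def Z_def avg_N bal_N)
  qed
  have "e j \<le> avg e (Suc j) + inner (a j - tau *\<^sub>R y j) \<eta>"
    unfolding \<eta>_def using j by (intro avg_inequality[of j]) (auto intro: le)
  then have "gain j * (e j - avg e (Suc j)) \<le> gain j * inner (a j - tau *\<^sub>R (Z + W + \<eta>)) \<eta>"
    unfolding y[symmetric] using gain_pos[OF j] by (intro mult_left_mono) auto
  moreover have "bound r tau (rpow (Suc j)) (geo r (Suc j)) (gsum (Suc j)) (quad (Suc j)) (a (Suc j)) Z W
      + 2 * gain j * inner (a j - tau *\<^sub>R (Z + W + \<eta>)) \<eta>
    \<le> bound r tau (rpow j) (geo r j) (gsum j) (quad j) (a j) (Z + gain j *\<^sub>R \<eta>) (W + g *\<^sub>R \<eta>)"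
    unfolding a Suc_simps[OF j]
    by (rule bound_step_le[OF r x step_facts(1-4)[OF j] tau step_facts(5-10)[OF j] g_def step_facts(11-13)[OF j] _ W0])
      (simp_all add: quad_def Suc_simps[OF j])
  ultimately show ?case
    using step.IH unfolding W unfolding Z bal_step[OF j, of e] Z_def[symmetric] W_def[symmetric] by simp
qed

text \<open>Jensen's inequality for the weights of \<open>bal\<close> at 0: nonnegativity is applied
  to a sequence that dominates \<open>\<delta> / 2\<close> times the squared distance of
  \<open>y k\<close> from the mean \<open>p\<close>.\<close>

lemma bal_0_ge:
  fixes y :: "nat \<Rightarrow> 'b::real_inner"
  assumes \<delta>: "\<delta> \<ge> 0" and e: "\<And>k. k \<le> N \<Longrightarrow> \<delta> / 2 * inner (y k) (y k) \<le> e k"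
  shows "\<delta> / 2 * inner (bal y 0) (bal y 0) \<le> bal e 0"
proof -
  define p where "p = bal y 0"
  have "0 \<le> e k - inner (y k) (\<delta> *\<^sub>R p) + \<delta> / 2 * inner p p" if "k \<le> N" for k
  proof -
    have "0 \<le> \<delta> / 2 * inner (y k - p) (y k - p)" using \<delta> by simp
    also have "\<dots> = \<delta> / 2 * inner (y k) (y k) - inner (y k) (\<delta> *\<^sub>R p) + \<delta> / 2 * inner p p"
      by (simp add: inner_diff_left inner_diff_right inner_commute[of p "y k"] algebra_simps)
    finally show ?thesis using e[OF that] by linarith
  qed
  from bal_ge_avg[where j = 0, OF this]
  have "0 \<le> gsum 0 * bal (\<lambda>k. e k - inner (y k) (\<delta> *\<^sub>R p) + \<delta> / 2 * inner p p) 0" by simp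
  moreover have "gsum 0 > 0" using r N by (simp add: gsum_def geo_pos)
  ultimately have "0 \<le> bal (\<lambda>k. e k - inner (y k) (\<delta> *\<^sub>R p) + \<delta> / 2 * inner p p) 0"
    by (simp add: zero_le_mult_iff)
  also have "\<dots> = bal e 0 - \<delta> / 2 * inner p p"
    using avg_bal_affine[of 0 e y "\<delta> *\<^sub>R p" "\<delta> / 2 * inner p p"] by (simp add: p_def)
  finally show ?thesis by (simp add: p_def)
qed

text \<open>At \<open>j = 0\<close> the terms with \<open>avg\<close> leave the bound, as
  \<open>geo r 0 = 0\<close> and \<open>quad 0 = 0\<close>. The surplus \<open>\<delta>\<close>
  enters through \<open>bal_0_ge\<close>, and completing the square in \<open>Z\<close> removes the
  gradients.\<close>

lemma sequence_bound:
  fixes a y :: "nat \<Rightarrow> 'b::real_inner" and h :: "nat \<Rightarrow> real"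
  defines "e \<equiv> \<lambda>k. inner (y k) (a k) - h k - tau / 2 * inner (y k) (y k)"
  assumes rec: "\<And>k. k < N \<Longrightarrow> a (Suc k) = r *\<^sub>R a k - y k"
    and le: "\<And>j k. j < k \<Longrightarrow> k \<le> N \<Longrightarrow> e j \<le> e k + inner (a j - tau *\<^sub>R y j) (y j - y k)"
    and \<delta>: "\<delta> \<ge> 0" and ge: "\<And>k. k \<le> N \<Longrightarrow> \<delta> / 2 * inner (y k) (y k) \<le> e k"
  shows "2 * h N + (1 - r) * inner (a N) (a N) \<le>
    ((1 - r) * r ^ (2 * N) + (r ^ (2 * N))\<^sup>2 / (tau + \<delta> + geo r (2 * N))) * inner (a 0) (a 0)"
proof -
  define A q where "A = r ^ (2 * N)" and "q = tau + \<delta> + geo r (2 * N)"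
  define Z where "Z = bal y 0"
  have q: "q > 0"
    using r x \<delta> by (simp add: q_def tau_def add_pos_nonneg geo_nonneg)
  have "2 * h N + (1 - r) * inner (a N) (a N) + 2 * bal e 0 \<le>
      (1 - r) * A * inner (a 0) (a 0) + 2 * A * inner (a 0) Z - (tau + geo r (2 * N)) * inner Z Z"
    using bound_invariant[where a = a and y = y and h = h, OF rec le[unfolded e_def], of 0]
    by (simp add: bound_def quad_def gap_0 rpow_def gsum_def A_def Z_def e_def)
  moreover have "\<delta> * inner Z Z \<le> 2 * bal e 0"
    using bal_0_ge[where y = y and e = e, OF \<delta> ge] by (simp add: Z_def)
  ultimately have "2 * h N + (1 - r) * inner (a N) (a N) \<le>
      (1 - r) * A * inner (a 0) (a 0) + 2 * A * inner (a 0) Z - q * inner Z Z"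
    by (simp add: q_def algebra_simps)
  moreover have "2 * A * inner (a 0) Z - q * inner Z Z \<le> A\<^sup>2 / q * inner (a 0) (a 0)"
  proof -
    have "0 \<le> q * inner ((A / q) *\<^sub>R a 0 - Z) ((A / q) *\<^sub>R a 0 - Z)" using q by simp
    also have "\<dots> = A\<^sup>2 / q * inner (a 0) (a 0) - 2 * A * inner (a 0) Z + q * inner Z Z"
      using q by (simp add: inner_diff_left inner_diff_right inner_commute[of Z "a 0"] power2_eq_square field_simps)
    finally show ?thesis by simp
  qed
  ultimately show ?thesis
    unfolding A_def[symmetric] q_def[symmetric] by (simp add: algebra_simps)
qed

end

section \<open>From sequences to functions\<close>

text \<open>The idea is to minimise the paraboloid above \<open>h\<close> at \<open>p\<close> minus the tangent at \<open>q\<close>.\<close>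

lemma cocoercive:
  fixes h :: "'a::real_inner \<Rightarrow> real"
  assumes D: "D > 0"
    and lower: "\<And>p q. h p + inner (y p) (q - p) \<le> h q"
    and upper: "\<And>p q. h q \<le> h p + inner (y p) (q - p) + D / 2 * (norm (q - p))\<^sup>2"
  shows "h q + inner (y q) (p - q) + 1 / (2 * D) * (norm (y p - y q))\<^sup>2 \<le> h p"
proof -
  define d z where "d = y p - y q" and "z = p - (1 / D) *\<^sub>R d"
  have "h q + inner (y q) (z - q) \<le> h p + inner (y p) (z - p) + D / 2 * (norm (z - p))\<^sup>2"
    using lower[of q z] upper[of z p] by linarith
  moreover have "inner (y q) (z - q) = inner (y q) (p - q) - 1 / D * inner (y q) d"
    by (simp add: z_def inner_diff_right inner_add_right algebra_simps)
  moreover have "inner (y p) (z - p) = - 1 / D * inner (y p) d"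
    by (simp add: z_def)
  moreover have "D / 2 * (norm (z - p))\<^sup>2 = 1 / (2 * D) * inner d d"
    using D by (simp add: z_def dot_square_norm power2_eq_square field_simps)
  moreover have "1 / D * inner (y p) d - 1 / D * inner (y q) d = 1 / D * inner d d"
    by (simp add: d_def inner_diff_left algebra_simps)
  moreover have "1 / D * inner d d = 2 * (1 / (2 * D) * inner d d)" by simp
  ultimately show ?thesis
    unfolding d_def[symmetric] power2_norm_eq_inner by simp
qed

text \<open>Stated for step size 1. Splitting off the quadratic with curvature \<open>1 - r\<close>
  leaves a convex \<open>h\<close> with gradient \<open>y\<close> and smoothness constant
  \<open>D\<close>; \<open>r > 1\<close>, a negative curvature, is allowed.\<close>

lemma gradient_descent_bound:
  fixes f :: "'a::real_inner \<Rightarrow> real" and G :: "'a \<Rightarrow> 'a" and z :: "nat \<Rightarrow> 'a"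
  assumes thr: "threshold r x N" and M: "1 - r < M" "M \<le> 1 + x"
    and lower: "\<And>p q. f p + inner (G p) (q - p) + (1 - r) / 2 * (norm (q - p))\<^sup>2 \<le> f q"
    and upper: "\<And>p q. f q \<le> f p + inner (G p) (q - p) + M / 2 * (norm (q - p))\<^sup>2"
    and star: "G s = 0"
    and step: "\<And>k. k < N \<Longrightarrow> z (Suc k) = z k - G (z k)"
  shows "f (z N) - f s \<le> M * (r ^ (2 * N) / (r ^ (2 * N) + M * geo r (2 * N))) * (norm (z 0 - s))\<^sup>2 / 2"
proof -
  interpret threshold r x N by (rule thr)
  define D where "D = M - (1 - r)"
  define h where "h p = f p - f s - (1 - r) / 2 * (norm (p - s))\<^sup>2" for p
  define y where "y p = G p - (1 - r) *\<^sub>R (p - s)" for p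
  have D: "D > 0" using M by (simp add: D_def)
  have sq: "(norm (q - s))\<^sup>2 = (norm (p - s))\<^sup>2 + 2 * inner (p - s) (q - p) + (norm (q - p))\<^sup>2" for p q
    unfolding power2_norm_eq_inner
    by (simp add: inner_diff_left inner_diff_right inner_commute algebra_simps)
  have sq': "k / 2 * (norm (q - s))\<^sup>2 = k / 2 * (norm (p - s))\<^sup>2 + k * inner (p - s) (q - p) + k / 2 * (norm (q - p))\<^sup>2"
    for k p q
    unfolding sq[of q p] distrib_left by simp
  have yi: "inner (y p) (q - p) = inner (G p) (q - p) - (1 - r) * inner (p - s) (q - p)" for p q
    unfolding y_def inner_diff_left[of "G p"] inner_scaleR_left ..
  have lower': "h p + inner (y p) (q - p) \<le> h q" for p q
    using lower[of p q] unfolding h_def yi sq'[of _ q p] by linarith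
  have Db: "D / 2 * b = M / 2 * b - (1 - r) / 2 * b" for b
    by (simp add: D_def field_simps)
  have upper': "h q \<le> h p + inner (y p) (q - p) + D / 2 * (norm (q - p))\<^sup>2" for p q
    using upper[of q p] unfolding h_def yi sq'[of _ q p] Db by linarith
  note co = cocoercive[of D h y, OF D lower' upper']
  define T where "T = 1 / D"
  define \<delta> where "\<delta> = T - tau"
  \<comment> \<open>\<open>M \<le> 1 + x\<close> means \<open>D \<le> r + x\<close>, so the
    cocoercivity constant \<open>T\<close> is at least \<open>tau\<close>. Between iterates only
    \<open>tau\<close> is used; the surplus is kept for the inequalities with the minimizer.\<close>
  have \<delta>: "\<delta> \<ge> 0"
    using M D r x by (simp add: \<delta>_def T_def tau_def D_def frac_le)
  have ys: "y s = 0" and hs: "h s = 0" by (simp_all add: y_def h_def star)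
  have co': "h q + inner (y q) (p - q) + T / 2 * inner (y p - y q) (y p - y q) \<le> h p" for p q
    using co[of q p] by (simp add: T_def power2_norm_eq_inner)
  have rec: "z (Suc k) - s = r *\<^sub>R (z k - s) - y (z k)" if "k < N" for k
    using step[OF that] by (simp add: y_def algebra_simps)
  have le: "inner (y (z j)) (z j - s) - h (z j) - tau / 2 * inner (y (z j)) (y (z j)) \<le>
      inner (y (z k)) (z k - s) - h (z k) - tau / 2 * inner (y (z k)) (y (z k))
      + inner (z j - s - tau *\<^sub>R y (z j)) (y (z j) - y (z k))" for j k
  proof -
    define u v a b where "u = y (z j)" and "v = y (z k)" and "a = z j - s" and "b = z k - s"
    have "tau / 2 * inner (u - v) (u - v) \<le> T / 2 * inner (u - v) (u - v)"
      using \<delta> by (intro mult_right_mono) (simp_all add: \<delta>_def)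
    moreover have "h (z k) + inner v (a - b) + T / 2 * inner (u - v) (u - v) \<le> h (z j)"
      using co'[of "z k" "z j"] by (simp add: u_def v_def a_def b_def)
    moreover have "inner v (a - b) = inner v a - inner v b"
      by (simp add: inner_diff_right)
    moreover have "inner (a - tau *\<^sub>R u) (u - v) = inner u a - inner v a - tau * inner u u + tau * inner u v"
      by (simp add: inner_diff_left inner_diff_right inner_commute[of a] algebra_simps)
    moreover have "tau / 2 * inner (u - v) (u - v) = tau / 2 * inner u u - tau * inner u v + tau / 2 * inner v v"
      by (simp add: inner_diff_left inner_diff_right inner_commute[of v u] field_simps)
    ultimately show ?thesis
      unfolding u_def[symmetric] v_def[symmetric] a_def[symmetric] b_def[symmetric] by linarith
  qed
  have ge: "\<delta> / 2 * inner (y (z k)) (y (z k)) \<le> inner (y (z k)) (z k - s) - h (z k) - tau / 2 * inner (y (z k)) (y (z k))" for k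
  proof -
    have "h (z k) + inner (y (z k)) (s - z k) + T / 2 * inner (y (z k)) (y (z k)) \<le> 0"
      using co'[of "z k" s] by (simp add: ys hs)
    moreover have "inner (y (z k)) (s - z k) = - inner (y (z k)) (z k - s)"
      by (simp add: inner_diff_right)
    moreover have "\<delta> / 2 * inner (y (z k)) (y (z k)) = T / 2 * inner (y (z k)) (y (z k)) - tau / 2 * inner (y (z k)) (y (z k))"
      unfolding \<delta>_def diff_divide_distrib left_diff_distrib ..
    ultimately show ?thesis by linarith
  qed
  have "2 * h (z N) + (1 - r) * inner (z N - s) (z N - s) \<le>
    ((1 - r) * r ^ (2 * N) + (r ^ (2 * N))\<^sup>2 / (tau + \<delta> + geo r (2 * N))) * inner (z 0 - s) (z 0 - s)"
    by (rule sequence_bound[where a = "\<lambda>k. z k - s" and y = "\<lambda>k. y (z k)" and h = "\<lambda>k. h (z k)"])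
      (erule rec, rule le, rule \<delta>, rule ge)
  moreover have "(1 - r) * r ^ (2 * N) + (r ^ (2 * N))\<^sup>2 / (tau + \<delta> + geo r (2 * N))
      = M * (r ^ (2 * N) / (r ^ (2 * N) + M * geo r (2 * N)))"
  proof -
    define A q where "A = r ^ (2 * N)" and "q = geo r (2 * N)"
    have Aq: "A > 0" "q > 0" "(1 - r) * q = 1 - A"
      using r N by (simp_all add: A_def q_def geo_pos geo_mult)
    define B where "B = A + M * q"
    have B: "D * (T + q) = B" "(1 - r) * B + A * D = M"
    proof -
      have "D * T = 1" using D by (simp add: T_def)
      then show "D * (T + q) = B" "(1 - r) * B + A * D = M"
        using Aq(3) unfolding B_def D_def by algebra+
    qed
    have "T + q > 0" using D Aq by (simp add: T_def add_pos_pos)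
    then have "B > 0" using B(1) D by (metis mult_pos_pos)
    then have "(1 - r) * A + A\<^sup>2 / (T + q) = A * ((1 - r) * B + A * D) / B"
      using D \<open>T + q > 0\<close> unfolding B(1)[symmetric] by (simp add: power2_eq_square field_simps)
    then show ?thesis
      unfolding A_def[symmetric] q_def[symmetric] B(2) by (simp add: B_def \<delta>_def mult.commute)
  qed
  moreover have "2 * h (z N) + (1 - r) * inner (z N - s) (z N - s) = 2 * (f (z N) - f s)"
    by (simp add: h_def dot_square_norm right_diff_distrib)
  ultimately have "2 * (f (z N) - f s) \<le> M * (r ^ (2 * N) / (r ^ (2 * N) + M * geo r (2 * N))) * inner (z 0 - s) (z 0 - s)"
    by (simp only:)
  moreover have "a \<le> c / 2" if "2 * a \<le> c" for a c :: real using that by simp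
  ultimately show ?thesis
    unfolding power2_norm_eq_inner by blast
qed

section \<open>Choice of the threshold\<close>

lemma geo_continuous: "continuous_on S (\<lambda>r. geo r k)"
  unfolding geo_def by (intro continuous_intros)

lemma geo_le_power:
  assumes "r \<ge> 1"
  shows "geo r k \<le> k * r ^ (k - 1)"
proof -
  have "geo r k \<le> of_nat (card {..<k}) * r ^ (k - 1)"
    unfolding geo_def using assms by (intro sum_bounded_above power_increasing) auto
  then show ?thesis by simp
qed

text \<open>Intermediate value theorem in \<open>x\<close> with \<open>r\<close> fixed; at
  \<open>x = 1\<close> the left side is at least \<open>r ^ (2 * N)\<close>.\<close>

lemma threshold_step_exists:
  assumes r: "r > 0" and N: "N > 0" and b: "0 \<le> b" "b \<le> 1"
    and le: "b ^ (2 * N) * (r ^ (2 * N) + (1 + b) * geo r (2 * N)) \<le> r ^ (2 * N)"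
  obtains x where "b \<le> x" "threshold r x N"
proof -
  let ?g = "\<lambda>x. x ^ (2 * N) * (r ^ (2 * N) + (1 + x) * geo r (2 * N))"
  have "r ^ (2 * N) \<le> ?g 1" using r by (simp add: geo_nonneg)
  moreover have "continuous_on {b..1} ?g" by (intro continuous_intros)
  ultimately obtain x where x: "b \<le> x" "?g x = r ^ (2 * N)"
    using IVT'[of ?g b "r ^ (2 * N)" 1] le b by auto
  have "x \<noteq> 0" using x(2) r N by (auto simp: power_0_left)
  then show thesis
    using x b r N by (intro that[of x]) (auto simp: threshold_def)
qed

text \<open>Intermediate value theorem in \<open>r\<close> with \<open>x\<close> fixed; increasing
  \<open>r\<close> means lowering the curvature.\<close>

lemma threshold_curvature_exists:
  assumes x: "0 < x" "x < 1" and N: "N > 0" and b: "b > 0"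
    and ge: "b ^ (2 * N) \<le> x ^ (2 * N) * (b ^ (2 * N) + (1 + x) * geo b (2 * N))"
  obtains r where "b \<le> r" "threshold r x N"
proof -
  define y where "y = x ^ (2 * N)"
  have y: "0 < y" "y < 1" using x N by (simp_all add: y_def power_less_one_iff)
  let ?g = "\<lambda>r. r ^ (2 * N) - y * (r ^ (2 * N) + (1 + x) * geo r (2 * N))"
  \<comment> \<open>At a large argument the pure power wins: \<open>geo_le_power\<close> bounds the
    sum by \<open>2 * N * R ^ (2 * N - 1)\<close>, and the last entry lets
    \<open>R * (1 - y)\<close> absorb the coefficient.\<close>
  define R where "R = max (max 1 b) (y * (1 + x) * (2 * N) / (1 - y))"
  have R: "R \<ge> 1" "R \<ge> b" "R \<ge> y * (1 + x) * (2 * N) / (1 - y)" by (simp_all add: R_def)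
  have "y * (1 + x) * geo R (2 * N) \<le> y * (1 + x) * ((2 * N) * R ^ (2 * N - 1))"
    using geo_le_power[OF R(1), of "2 * N"] y x by (intro mult_left_mono) auto
  also have "\<dots> = (y * (1 + x) * (2 * N)) * R ^ (2 * N - 1)" by simp
  also have "\<dots> \<le> (R * (1 - y)) * R ^ (2 * N - 1)"
    using R y by (intro mult_right_mono) (auto simp: field_simps)
  also have "\<dots> = R ^ (2 * N) * (1 - y)"
    using N by (simp add: power_eq_if mult_ac)
  finally have "0 \<le> ?g R" by (simp add: algebra_simps)
  moreover have "?g b \<le> 0" using ge by (simp add: y_def)
  moreover have "continuous_on {b..R} ?g" by (intro continuous_intros geo_continuous)
  ultimately obtain r where "b \<le> r" "?g r = 0"
    using IVT'[of ?g b 0 R] R by auto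
  then show thesis
    using x N b by (intro that[of r]) (auto simp: threshold_def y_def)
qed

lemma sum_powi_neg:
  fixes r :: real
  assumes "r \<noteq> 0"
  shows "(\<Sum>j = 1..k. r powi (- int j)) = geo r k / r ^ k"
proof (induction k)
  case (Suc k)
  have "geo r (Suc k) / r ^ Suc k = r powi (- int (Suc k)) + geo r k / r ^ k"
    using assms by (simp only: geo_Suc power_int_minus power_int_of_nat) (simp add: field_simps)
  then show ?case using Suc by simp
qed simp

lemma sum_rate_eq:
  assumes "1 - \<gamma> * \<mu> > 0"
  shows "sum_rate \<mu> L \<gamma> N =
    (1 - \<gamma> * \<mu>) ^ (2 * N) / ((1 - \<gamma> * \<mu>) ^ (2 * N) + \<gamma> * L * geo (1 - \<gamma> * \<mu>) (2 * N))"
proof -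
  define p where "p = (1 - \<gamma> * \<mu>) ^ (2 * N)"
  have "p > 0" using assms by (simp add: p_def)
  then have "1 + c * (g / p) = (p + c * g) / p" for c g by (simp add: field_simps)
  then show ?thesis
    using assms unfolding sum_rate_def sum_powi_neg[OF less_imp_neq[OF assms, symmetric]] p_def[symmetric] by simp
qed

text \<open>Otherwise a gradient step of size \<open>1 / L\<close> would lower the value by at least
  \<open>(norm g)\<^sup>2 / (2 * L)\<close>.\<close>

lemma smooth_minimizer_grad:
  fixes f :: "'a::euclidean_space \<Rightarrow> real"
  assumes "smooth L f" "L > 0" "\<And>y. f s \<le> f y"
  shows "grad f s = 0"
proof -
  define g where "g = grad f s"
  have "0 \<le> f s - f (s - (1 / L) *\<^sub>R g) + inner g (s - (1 / L) *\<^sub>R g - s) + L / 2 * (norm (s - (s - (1 / L) *\<^sub>R g)))\<^sup>2"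
    using assms(1) unfolding smooth_def g_def by blast
  also have "\<dots> = f s - f (s - (1 / L) *\<^sub>R g) - (norm g)\<^sup>2 / (2 * L)"
    using assms(2) by (simp add: dot_square_norm power2_eq_square field_simps)
  finally have "(norm g)\<^sup>2 / (2 * L) \<le> 0"
    using assms(3)[of "s - (1 / L) *\<^sub>R g"] by linarith
  then show ?thesis
    using assms(2) by (simp add: g_def divide_le_0_iff)
qed

theorem theorem1p3:
  fixes f :: "real ^ 'd \<Rightarrow> real"
    and x :: "nat \<Rightarrow> real ^ 'd"
    and xstar :: "real ^ 'd"
    and N :: nat
    and \<mu> L \<gamma> :: real
  assumes "N \<ge> 1"
    and "0 \<le> \<mu>" and "\<mu> < L"
    and "\<gamma> \<in> {0<..<2 / L}"
    and "\<forall>y. f differentiable (at y)"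
    and "strongly_convex \<mu> f"
    and "smooth L f"
    and "\<forall>y. f xstar \<le> f y"
    and "\<forall>k<N. x (Suc k) = x k - \<gamma> *\<^sub>R grad f (x k)"
  shows "f (x N) - f xstar \<le>
           max (sum_rate \<mu> L \<gamma> N) ((1 - \<gamma> * L) ^ (2 * N)) * (L * (norm (x 0 - xstar))\<^sup>2 / 2)"
proof -
  have N: "N > 0" and L: "L > 0" and \<gamma>: "\<gamma> > 0" "\<gamma> * L < 2"
    using assms(1-4) by (auto simp: field_simps)
  define M where "M = \<gamma> * L"
  have M: "M > 0" "M < 2" "\<gamma> * \<mu> < M"
    using L \<gamma> assms(3) by (simp_all add: M_def)
  define G where "G p = \<gamma> *\<^sub>R grad f p" for p
  have star: "G xstar = 0"
    using smooth_minimizer_grad[OF assms(7) L, of xstar] assms(8) by (simp add: G_def)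
  have upper: "\<gamma> * f q \<le> \<gamma> * f p + inner (G p) (q - p) + M / 2 * (norm (q - p))\<^sup>2" for p q
  proof -
    have "0 \<le> f p - f q + inner (grad f p) (q - p) + L / 2 * (norm (q - p))\<^sup>2"
      using assms(7) by (simp add: smooth_def norm_minus_commute)
    then have "0 \<le> \<gamma> * (f p - f q + inner (grad f p) (q - p) + L / 2 * (norm (q - p))\<^sup>2)"
      using \<gamma> by simp
    then show ?thesis by (simp add: G_def M_def algebra_simps)
  qed
  \<comment> \<open>Allowing larger \<open>r\<close> weakens the curvature assumption; the second
    case below needs this freedom.\<close>
  have lower: "\<gamma> * f p + inner (G p) (q - p) + (1 - r) / 2 * (norm (q - p))\<^sup>2 \<le> \<gamma> * f q"
    if "1 - \<gamma> * \<mu> \<le> r" for r p q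
  proof -
    have "f p - f q + inner (grad f p) (q - p) + \<mu> / 2 * (norm (q - p))\<^sup>2 \<le> 0"
      using assms(6) by (simp add: strongly_convex_def norm_minus_commute)
    then have "\<gamma> * (f p - f q + inner (grad f p) (q - p) + \<mu> / 2 * (norm (q - p))\<^sup>2) \<le> 0"
      using \<gamma> by (simp add: mult_le_0_iff)
    moreover have "(1 - r) / 2 * (norm (q - p))\<^sup>2 \<le> \<gamma> * \<mu> / 2 * (norm (q - p))\<^sup>2"
      using that by (intro mult_right_mono) auto
    moreover have "\<gamma> * (f p - f q + inner (grad f p) (q - p) + \<mu> / 2 * (norm (q - p))\<^sup>2) =
        \<gamma> * f p - \<gamma> * f q + inner (G p) (q - p) + \<gamma> * \<mu> / 2 * (norm (q - p))\<^sup>2"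
      by (simp add: G_def distrib_left right_diff_distrib)
    ultimately show ?thesis by linarith
  qed
  have bound: "f (x N) - f xstar \<le> r ^ (2 * N) / (r ^ (2 * N) + M * geo r (2 * N)) * (L * (norm (x 0 - xstar))\<^sup>2 / 2)"
    if "threshold r u N" "1 - \<gamma> * \<mu> \<le> r" "1 - r < M" "M \<le> 1 + u" for r u
  proof -
    have "\<gamma> * f (x N) - \<gamma> * f xstar \<le>
        M * (r ^ (2 * N) / (r ^ (2 * N) + M * geo r (2 * N))) * (norm (x 0 - xstar))\<^sup>2 / 2"
      by (rule gradient_descent_bound[where G = G and f = "\<lambda>p. \<gamma> * f p" and z = x, OF that(1,3,4) lower[OF that(2)] upper star])
        (use assms(9) in \<open>simp add: G_def\<close>)
    then have "\<gamma> * (f (x N) - f xstar) \<le>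
        \<gamma> * (r ^ (2 * N) / (r ^ (2 * N) + M * geo r (2 * N)) * (L * (norm (x 0 - xstar))\<^sup>2 / 2))"
      by (simp add: M_def algebra_simps)
    then show ?thesis using \<gamma>(1) by (simp only: mult_le_cancel_left_pos)
  qed
  have scale: "0 \<le> L * (norm (x 0 - xstar))\<^sup>2 / 2" using L by simp
  let ?r = "1 - \<gamma> * \<mu>"
  let ?u = "M - 1"
  show ?thesis
  \<comment> \<open>If \<open>M - 1\<close> is at most the threshold of \<open>?r\<close>,
    \<open>?r\<close> is kept. Otherwise \<open>M - 1\<close> is kept and \<open>r\<close> is
    raised. The second case includes \<open>?r \<le> 0\<close>, hence also the convention for
    \<open>1 - \<gamma> * \<mu> = 0\<close>, and uses only the second argument of the
    maximum.\<close>
  proof (cases "?r > 0 \<and> (?u \<le> 0 \<or> ?u ^ (2 * N) * (?r ^ (2 * N) + (1 + ?u) * geo ?r (2 * N)) \<le> ?r ^ (2 * N))")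
    case True
    define b where "b = max 0 ?u"
    have "b ^ (2 * N) * (?r ^ (2 * N) + (1 + b) * geo ?r (2 * N)) \<le> ?r ^ (2 * N)"
      using True N by (cases "?u \<le> 0") (auto simp: b_def max_def power_0_left)
    then obtain u where u: "b \<le> u" "threshold ?r u N"
      using threshold_step_exists[of ?r N b] True N M by (auto simp: b_def)
    have "f (x N) - f xstar \<le> sum_rate \<mu> L \<gamma> N * (L * (norm (x 0 - xstar))\<^sup>2 / 2)"
      using bound[OF u(2)] u(1) M True by (simp add: b_def M_def sum_rate_eq)
    also have "\<dots> \<le> max (sum_rate \<mu> L \<gamma> N) ((1 - \<gamma> * L) ^ (2 * N)) * (L * (norm (x 0 - xstar))\<^sup>2 / 2)"
      using scale by (intro mult_right_mono) auto
    finally show ?thesis .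
  next
    case False
    have u: "0 < ?u" "?u < 1"
      using False M by auto
    have "\<exists>b>0. ?r \<le> b \<and> b ^ (2 * N) \<le> ?u ^ (2 * N) * (b ^ (2 * N) + (1 + ?u) * geo b (2 * N))"
    proof (cases "?r > 0")
      case True
      then show ?thesis using False by (intro exI[of _ ?r]) auto
    next
      case neg: False
      \<comment> \<open>The witness is \<open>?u\<close> itself, for which the inequality reduces to
        the bracket being at least 1.\<close>
      have "geo ?u (2 * N) = 1 + ?u * geo ?u (2 * N - 1)"
        using geo_Suc[of ?u "2 * N - 1"] N by simp
      then have "1 \<le> geo ?u (2 * N)" using u by (simp add: geo_nonneg)
      then have "1 * 1 \<le> (1 + ?u) * geo ?u (2 * N)" using u by (intro mult_mono) auto
      moreover have u2N: "0 \<le> ?u ^ (2 * N)" using u by simp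
      ultimately have "1 \<le> ?u ^ (2 * N) + (1 + ?u) * geo ?u (2 * N)" by linarith
      from mult_left_mono[OF this u2N]
      have "?u ^ (2 * N) * 1 \<le> ?u ^ (2 * N) * (?u ^ (2 * N) + (1 + ?u) * geo ?u (2 * N))" .
      then show ?thesis using u neg by (intro exI[of _ ?u]) auto
    qed
    then obtain b where b: "b > 0" "?r \<le> b"
      "b ^ (2 * N) \<le> ?u ^ (2 * N) * (b ^ (2 * N) + (1 + ?u) * geo b (2 * N))"
      by blast
    obtain r where r: "b \<le> r" "threshold r ?u N"
      using threshold_curvature_exists[OF u N b(1,3)] .
    have r0: "r > 0" and eq: "?u ^ (2 * N) * (r ^ (2 * N) + M * geo r (2 * N)) = r ^ (2 * N)"
      using r(2) by (simp_all add: threshold_def)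
    have "r ^ (2 * N) + M * geo r (2 * N) > 0"
      using r0 M by (simp add: add_pos_nonneg geo_nonneg)
    \<comment> \<open>Since \<open>M = 1 + ?u\<close>, the threshold equation turns the sublinear
      rate of \<open>r\<close> into \<open>?u ^ (2 * N)\<close>.\<close>
    then have "r ^ (2 * N) / (r ^ (2 * N) + M * geo r (2 * N)) = ?u ^ (2 * N)"
      using eq by (subst nonzero_divide_eq_eq) auto
    also have "\<dots> = (1 - \<gamma> * L) ^ (2 * N)"
      by (simp add: M_def power_mult power2_commute)
    finally have "f (x N) - f xstar \<le> (1 - \<gamma> * L) ^ (2 * N) * (L * (norm (x 0 - xstar))\<^sup>2 / 2)"
      using bound[OF r(2)] r(1) b(2) r0 M u by auto
    also have "\<dots> \<le> max (sum_rate \<mu> L \<gamma> N) ((1 - \<gamma> * L) ^ (2 * N)) * (L * (norm (x 0 - xstar))\<^sup>2 / 2)"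
      using scale by (intro mult_right_mono) auto
    finally show ?thesis .
  qed
qed

end
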